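(* Let $D$ be a knot projection. There is a bijection between discrete Morse functions on $\Xi(D)$ induced by admissible partial Kauffman states and pairs of rooted orthogonal spanning forests in $G_b$ and $G_w$. In particular, when the admissible partial Kauffman states are maximal, this reduces (restricts) to a bijection between perfect discrete Morse functions on $\Xi(D)$ and pairs of rooted orthogonal spanning trees in $G_b$ and $G_w$.
   Context: Setting. $D$ is the projection of a knot diagram with at least one crossing, viewed as a connected 4-valent graph on $S^2$, with a chequerboard black/white colouring of the regions of $S^2\setminus D$. The black graph $G_b$ has the black regions as vertices and one edge for each crossing, joining the two black regions opposite each other at that crossing; the white graph $G_w$ is defined analogously and is the plane dual of $G_b$. The overlaid Tait graph $\Gamma(D)$ is the superimposition of $G_b$ and $G_w$ on $S^2$: its vertices are the black regions, the white regions and the crossings, and its edges are the half-edges of $G_b$ and $G_w$, each joining a region to an incident crossing. A partial Kauffman state is an injection from a subset of the crossings of $D$ to the set of regions $V(G_w)\sqcup V(G_b)$, pairing each crossing in the subset with exactly one of its four adjacent regions; equivalently, a matching on $\Gamma(D)$. It is admissible if there is at least one unpaired region of each colour, and maximal if every crossing is paired. $\Xi(D)$ is the cell structure on $S^2$ whose 2-cells are given by the vertices of $G_w$, 1-cells by the crossings, and 0-cells by the vertices of $G_b$. Its poset graph is $\Gamma(D)$, with edges oriented from white vertices to crossings and from crossings to black vertices. A discrete Morse function on $\Xi(D)$ means an equivalence class of such functions, i.e. a matching on $\Gamma(D)$ that is acyclic: reversing the orientation of all matched edges yields a directed graph without directed cycles. It is perfect if the number of critical (unmatched) cells is minimal,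 i.e. exactly one 0-cell and one 2-cell are critical. A spanning forest is a spanning acyclic subgraph (isolated vertices are allowed as components); it is rooted if a vertex is chosen in each connected component. Spanning forests $F\subset G_b$ and $F'\subset G_w=G_b^*$ are orthogonal if there is no edge $e$ with $e\in F$ and $e^*\in F'$, where $e^*$ is the dual edge of $e$. *)

theory Defs
  imports
    "HOL-Combinatorics.Permutations"
    "HOL-Combinatorics.Orbits"
    "Graph_Theory.Arc_Walk"
begin

section \<open>Knot projections\<close>

text \<open>
  A 4-valent graph cellularly embedded in the sphere, as a combinatorial map. The darts are the
  half-edges of the graph, each thought of as leaving its crossing; \<open>flip\<close> exchanges
  the two halves of an edge; \<open>rot\<close> sends a dart to the counterclockwise next one at the
  same crossing. Crossings, edges and regions are orbits of darts. A dart \<open>d\<close> also stands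
  for the corner at its crossing between \<open>d\<close> and \<open>rot d\<close>, which lies in the
  region to the left of \<open>d\<close>.
\<close>

record 'd projection =
  darts :: "'d set"
  flip :: "'d \<Rightarrow> 'd"
  rot :: "'d \<Rightarrow> 'd"
  black :: "'d set set"

definition crossing_at :: "'d projection \<Rightarrow> 'd \<Rightarrow> 'd set" where
  "crossing_at P d = orbit (rot P) d"

definition edge_at :: "'d projection \<Rightarrow> 'd \<Rightarrow> 'd set" where
  "edge_at P d = {d, flip P d}"

text \<open>
  Keeping the region on the left, one follows \<open>d\<close> to its other end, where one arrives
  along \<open>flip d\<close>, and leaves along the dart clockwise next to \<open>flip d\<close>.
\<close>

definition region_at :: "'d projection \<Rightarrow> 'd \<Rightarrow> 'd set" where
  "region_at P d = orbit (\<lambda>e. inv (rot P) (flip P e)) d"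

definition crossings :: "'d projection \<Rightarrow> 'd set set" where
  "crossings P = crossing_at P ` darts P"

definition edges :: "'d projection \<Rightarrow> 'd set set" where
  "edges P = edge_at P ` darts P"

definition regions :: "'d projection \<Rightarrow> 'd set set" where
  "regions P = region_at P ` darts P"

definition white :: "'d projection \<Rightarrow> 'd set set" where
  "white P = regions P - black P"

definition four_valent_map :: "'d projection \<Rightarrow> bool" where
  "four_valent_map P \<longleftrightarrow>
     finite (darts P) \<and>
     flip P permutes darts P \<and>
     (\<forall>d\<in>darts P. flip P d \<noteq> d \<and> flip P (flip P d) = d) \<and>
     rot P permutes darts P \<and>
     (\<forall>d\<in>darts P. card (crossing_at P d) = 4)"

definition connected_map :: "'d projection \<Rightarrow> bool" where
  "connected_map P \<longleftrightarrow>
     (\<forall>d\<in>darts P. \<forall>e\<in>darts P. (d, e) \<in> {(x, y). y = flip P x \<or> y = rot P x}\<^sup>*)"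

definition spherical :: "'d projection \<Rightarrow> bool" where
  "spherical P \<longleftrightarrow>
     int (card (crossings P)) - int (card (edges P)) + int (card (regions P)) = 2"

text \<open>
  The projected link has one component: any dart is reached from any other by running along
  edges and going straight ahead at crossings.
\<close>

definition single_component :: "'d projection \<Rightarrow> bool" where
  "single_component P \<longleftrightarrow>
     (\<forall>d\<in>darts P. \<forall>e\<in>darts P. (d, e) \<in> {(x, y). y = flip P x \<or> y = rot P (rot P x)}\<^sup>*)"

definition chequerboard :: "'d projection \<Rightarrow> bool" where
  "chequerboard P \<longleftrightarrow>
     black P \<subseteq> regions P \<and>
     (\<forall>d\<in>darts P. region_at P d \<in> black P \<longleftrightarrow> region_at P (flip P d) \<notin> black P)"

definition knot_projection :: "'d projection \<Rightarrow> bool" where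
  "knot_projection P \<longleftrightarrow>
     darts P \<noteq> {} \<and> four_valent_map P \<and> connected_map P \<and> spherical P \<and>
     single_component P \<and> chequerboard P"


section \<open>Undirected multigraphs and rooted spanning forests\<close>

text \<open>
  Graph_Theory's forests and trees are digraphs without directed cycles, which is not the notion
  needed here. \<open>ends\<close> is the set of end vertices of an edge, a singleton for a loop.
\<close>

record ('v, 'e) multigraph =
  vertices :: "'v set"
  medges :: "'e set"
  ends :: "'e \<Rightarrow> 'v set"

text \<open>
  Spanning subgraphs are given by their edge sets. Loops are cycles of length one, pairs of
  parallel edges give cycles of length two.
\<close>

definition cycle_in :: "('v, 'e) multigraph \<Rightarrow> 'e set \<Rightarrow> 'v list \<Rightarrow> 'e list \<Rightarrow> bool" where
  "cycle_in G F vs es \<longleftrightarrow>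
     es \<noteq> [] \<and> length vs = length es \<and> distinct vs \<and> distinct es \<and> set es \<subseteq> F \<and>
     (\<forall>i<length es. ends G (es ! i) = {vs ! i, vs ! (Suc i mod length es)})"

definition linked :: "('v, 'e) multigraph \<Rightarrow> 'e set \<Rightarrow> ('v \<times> 'v) set" where
  "linked G F = {(u, v). \<exists>e\<in>F. ends G e = {u, v}}\<^sup>*"

definition components :: "('v, 'e) multigraph \<Rightarrow> 'e set \<Rightarrow> 'v set set" where
  "components G F = {{v \<in> vertices G. (u, v) \<in> linked G F} | u. u \<in> vertices G}"

definition spanning_forest :: "('v, 'e) multigraph \<Rightarrow> 'e set \<Rightarrow> bool" where
  "spanning_forest G F \<longleftrightarrow> F \<subseteq> medges G \<and> (\<nexists>vs es. cycle_in G F vs es)"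

definition spanning_tree :: "('v, 'e) multigraph \<Rightarrow> 'e set \<Rightarrow> bool" where
  "spanning_tree G F \<longleftrightarrow>
     spanning_forest G F \<and> (\<forall>u\<in>vertices G. \<forall>v\<in>vertices G. (u, v) \<in> linked G F)"

text \<open>A choice of roots, one in each component.\<close>

definition rooting :: "('v, 'e) multigraph \<Rightarrow> 'e set \<Rightarrow> 'v set \<Rightarrow> bool" where
  "rooting G F R \<longleftrightarrow> R \<subseteq> vertices G \<and> (\<forall>C\<in>components G F. \<exists>!r. r \<in> R \<inter> C)"


section \<open>The black and white graphs\<close>

text \<open>
  Of the four corners at a crossing, two opposite ones are black and two are white, so each
  crossing is an edge of either graph. The edge of one graph at a crossing is dual to the edge
  of the other graph at the same crossing; thus edges of both are named by crossings, and
  \<open>e\<^sup>*\<close> has the same name as \<open>e\<close>.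
\<close>

definition black_graph :: "'d projection \<Rightarrow> ('d set, 'd set) multigraph" where
  "black_graph P =
     \<lparr>vertices = black P, medges = crossings P, ends = (\<lambda>c. region_at P ` c \<inter> black P)\<rparr>"

definition white_graph :: "'d projection \<Rightarrow> ('d set, 'd set) multigraph" where
  "white_graph P =
     \<lparr>vertices = white P, medges = crossings P, ends = (\<lambda>c. region_at P ` c \<inter> white P)\<rparr>"

definition orthogonal :: "'d set set \<Rightarrow> 'd set set \<Rightarrow> bool" where
  "orthogonal F F' \<longleftrightarrow> F \<inter> F' = {}"

type_synonym 'd rooted_subgraph = "'d set set \<times> 'd set set"

definition rooted_orthogonal_spanning_forests ::
    "'d projection \<Rightarrow> ('d rooted_subgraph \<times> 'd rooted_subgraph) set" where
  "rooted_orthogonal_spanning_forests P =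
     {((F, R), (F', R')).
        spanning_forest (black_graph P) F \<and> rooting (black_graph P) F R \<and>
        spanning_forest (white_graph P) F' \<and> rooting (white_graph P) F' R' \<and>
        orthogonal F F'}"

definition rooted_orthogonal_spanning_trees ::
    "'d projection \<Rightarrow> ('d rooted_subgraph \<times> 'd rooted_subgraph) set" where
  "rooted_orthogonal_spanning_trees P =
     {((F, R), (F', R')).
        spanning_tree (black_graph P) F \<and> rooting (black_graph P) F R \<and>
        spanning_tree (white_graph P) F' \<and> rooting (white_graph P) F' R' \<and>
        orthogonal F F'}"


section \<open>Discrete Morse functions\<close>

datatype 'd cell = Crossing "'d set" | Region "'d set"

text \<open>
  The overlaid Tait graph, oriented as the poset graph of the cell structure whose 2-cells,
  1-cells and 0-cells are the white regions, crossings and black regions. Its edges are the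
  half-edges of the black and white graphs, that is, the corners. A crossing meeting a region in
  two corners is joined to it by two arcs, so it can be matched with that region only at the
  price of a directed 2-cycle (it is not a regular face).
\<close>

definition poset_graph :: "'d projection \<Rightarrow> ('d cell, 'd) pre_digraph" where
  "poset_graph P =
     \<lparr>verts = Region ` regions P \<union> Crossing ` crossings P,
      arcs = darts P,
      tail = (\<lambda>d. if region_at P d \<in> black P then Crossing (crossing_at P d)
                  else Region (region_at P d)),
      head = (\<lambda>d. if region_at P d \<in> black P then Region (region_at P d)
                  else Crossing (crossing_at P d))\<rparr>"

definition matching :: "('a, 'b) pre_digraph \<Rightarrow> 'b set \<Rightarrow> bool" where
  "matching G M \<longleftrightarrow>
     M \<subseteq> arcs G \<and>
     (\<forall>a\<in>M. \<forall>b\<in>M. a \<noteq> b \<longrightarrow> {tail G a, head G a} \<inter> {tail G b, head G b} = {})"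

definition reverse_arcs :: "('a, 'b) pre_digraph \<Rightarrow> 'b set \<Rightarrow> ('a, 'b) pre_digraph" where
  "reverse_arcs G M =
     G\<lparr>tail := (\<lambda>a. if a \<in> M then head G a else tail G a),
       head := (\<lambda>a. if a \<in> M then tail G a else head G a)\<rparr>"

definition discrete_morse :: "'d projection \<Rightarrow> 'd set \<Rightarrow> bool" where
  "discrete_morse P M \<longleftrightarrow>
     matching (poset_graph P) M \<and>
     (\<nexists>p. pre_digraph.cycle (reverse_arcs (poset_graph P) M) p)"

definition critical_cells :: "'d projection \<Rightarrow> 'd set \<Rightarrow> 'd cell set" where
  "critical_cells P M =
     verts (poset_graph P) - (tail (poset_graph P) ` M \<union> head (poset_graph P) ` M)"

text \<open>
  As the Euler characteristic of the sphere is 2, the minimum is attained when one 0-cell, one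
  2-cell and no other cell is critical.
\<close>

definition perfect :: "'d projection \<Rightarrow> 'd set \<Rightarrow> bool" where
  "perfect P M \<longleftrightarrow>
     discrete_morse P M \<and>
     (\<forall>M'. discrete_morse P M' \<longrightarrow> card (critical_cells P M) \<le> card (critical_cells P M'))"


section \<open>Partial Kauffman states\<close>

definition partial_kauffman_state :: "'d projection \<Rightarrow> ('d set \<rightharpoonup> 'd set) \<Rightarrow> bool" where
  "partial_kauffman_state P s \<longleftrightarrow>
     dom s \<subseteq> crossings P \<and> inj_on s (dom s) \<and>
     (\<forall>c r. s c = Some r \<longrightarrow> r \<in> region_at P ` c)"

definition admissible :: "'d projection \<Rightarrow> ('d set \<rightharpoonup> 'd set) \<Rightarrow> bool" where
  "admissible P s \<longleftrightarrow> \<not> black P \<subseteq> ran s \<and> \<not> white P \<subseteq> ran s"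

definition maximal_state :: "'d projection \<Rightarrow> ('d set \<rightharpoonup> 'd set) \<Rightarrow> bool" where
  "maximal_state P s \<longleftrightarrow> dom s = crossings P"

text \<open>
  The matching of a state consists of one corner for each paired crossing, lying in the region
  that the crossing is paired with.
\<close>

definition matching_of_state :: "'d projection \<Rightarrow> ('d set \<rightharpoonup> 'd set) \<Rightarrow> 'd set \<Rightarrow> bool" where
  "matching_of_state P s M \<longleftrightarrow>
     M \<subseteq> darts P \<and> bij_betw (crossing_at P) M (dom s) \<and>
     (\<forall>d\<in>M. s (crossing_at P d) = Some (region_at P d))"

definition admissible_morse :: "'d projection \<Rightarrow> 'd set set" where
  "admissible_morse P =
     {M. discrete_morse P M \<and>
         (\<exists>s. partial_kauffman_state P s \<and> admissible P s \<and> matching_of_state P s M)}"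

definition maximal_admissible_morse :: "'d projection \<Rightarrow> 'd set set" where
  "maximal_admissible_morse P =
     {M. discrete_morse P M \<and>
         (\<exists>s. partial_kauffman_state P s \<and> admissible P s \<and> maximal_state P s \<and>
              matching_of_state P s M)}"

end

theory Submission
  imports Defs
begin

text \<open>
  A corner of a matching pairs a region with an edge of the black or of the white graph; crossing
  that edge leads to a next region of the same colour. A directed path of the reversed poset graph
  that has reached a black region stays with black regions and the crossings matched with them,
  following next regions, and dually for white. So acyclicity of the Morse matching splits into
  acyclicity of the next-region maps of the two colours. In one colour, an acyclic such matching is
  a forest directed towards its unmatched vertices, one in each component, and it is recovered from
  the forest and these roots.

  By Euler's formula the number of critical cells is \<open>2 (b + w) - 2\<close>, for \<open>b\<close> black and \<open>w\<close>
  white roots, so it is at least 2, with equality exactly for maximal matchings, and exactly for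
  pairs of trees. Such matchings exist: given a black spanning tree, if some set \<open>W\<close> of white
  regions were separated from the rest by the crossings of the tree, the crossings where \<open>W\<close> meets
  its complement would have an even number of corners in each black region, while a nonempty subset
  of a tree has a leaf.
\<close>

section \<open>Acyclic matchings and rooted forests in multigraphs\<close>

definition adjacency :: "('v, 'e) multigraph \<Rightarrow> 'e set \<Rightarrow> ('v \<times> 'v) set" where
  "adjacency G F = {(u, v). \<exists>e\<in>F. ends G e = {u, v}}"

lemma linked_adjacency: "linked G F = (adjacency G F)\<^sup>*"
  by (simp add: linked_def adjacency_def)

lemma sym_linked: "(u, v) \<in> linked G F \<Longrightarrow> (v, u) \<in> linked G F"
proof -
  have "sym (adjacency G F)"
    by (auto simp: sym_def adjacency_def insert_commute)
  then show "(u, v) \<in> linked G F \<Longrightarrow> (v, u) \<in> linked G F"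
    unfolding linked_adjacency by (metis sym_rtrancl symD)
qed

lemma linked_trans: "(u, v) \<in> linked G F \<Longrightarrow> (v, w) \<in> linked G F \<Longrightarrow> (u, w) \<in> linked G F"
  unfolding linked_adjacency by (rule rtrancl_trans)

lemma linked_refl: "(u, u) \<in> linked G F"
  unfolding linked_adjacency by simp

lemma linked_edge: "e \<in> F \<Longrightarrow> ends G e = {u, v} \<Longrightarrow> (u, v) \<in> linked G F"
  unfolding linked_adjacency adjacency_def by blast

lemma linked_mono: "F \<subseteq> F' \<Longrightarrow> (u, v) \<in> linked G F \<Longrightarrow> (u, v) \<in> linked G F'"
proof -
  assume "F \<subseteq> F'"
  then have "adjacency G F \<subseteq> adjacency G F'" unfolding adjacency_def by blast
  then show "(u, v) \<in> linked G F \<Longrightarrow> (u, v) \<in> linked G F'"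
    unfolding linked_adjacency using rtrancl_mono by blast
qed

text \<open>
  The pair \<open>(v, e)\<close> stands for the edge \<open>e\<close> being matched with its end \<open>v\<close>; descending
  from \<open>v\<close> one crosses \<open>e\<close>. A loop \<open>e\<close> puts \<open>(v, v)\<close> into the descent relation.
\<close>

definition descent :: "('v, 'e) multigraph \<Rightarrow> ('v \<times> 'e) set \<Rightarrow> ('v \<times> 'v) set" where
  "descent G A = {(v, w). \<exists>e. (v, e) \<in> A \<and> ends G e = {v, w}}"

text \<open>Forman's discrete gradient vector field on a graph, taken as a one-dimensional complex.
  Matched loops are ruled out by acyclicity rather than by a separate clause.\<close>

definition gradient_field :: "('v, 'e) multigraph \<Rightarrow> ('v \<times> 'e) set \<Rightarrow> bool" where
  "gradient_field G A \<longleftrightarrow>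
     A \<subseteq> vertices G \<times> medges G \<and> (\<forall>(v, e)\<in>A. v \<in> ends G e) \<and>
     inj_on fst A \<and> inj_on snd A \<and> acyclic (descent G A)"

definition roots :: "('v, 'e) multigraph \<Rightarrow> ('v \<times> 'e) set \<Rightarrow> 'v set" where
  "roots G A = vertices G - fst ` A"

text \<open>A shortest walk from \<open>u\<close> to \<open>w\<close> that avoids \<open>e\<close>
  repeats no vertex and hence no edge, so \<open>e\<close> closes it to a cycle. For
  \<open>u = w\<close> the walk is empty and the cycle is the loop \<open>e\<close> itself.\<close>

lemma cycle_closing_edge:
  assumes e: "e \<in> F" "ends G e = {u, w}" and uw: "(u, w) \<in> linked G (F - {e})"
  shows "\<exists>vs es. cycle_in G F vs es"
proof -
  let ?S = "adjacency G (F - {e})"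
  obtain n where n: "(u, w) \<in> ?S ^^ n" "\<And>m. (u, w) \<in> ?S ^^ m \<Longrightarrow> n \<le> m"
    using uw LeastI_ex[of "\<lambda>n. (u, w) \<in> ?S ^^ n"] Least_le[of "\<lambda>n. (u, w) \<in> ?S ^^ n"]
    unfolding linked_adjacency rtrancl_is_UN_relpow by blast
  then obtain f where f: "f 0 = u" "f n = w" "\<And>i. i < n \<Longrightarrow> (f i, f (Suc i)) \<in> ?S"
    unfolding relpow_fun_conv by blast
  have sub: "(f i, f (i + k)) \<in> ?S ^^ k" if "i + k \<le> n" for i k
    unfolding relpow_fun_conv using that f(3)
    by (intro exI[of _ "\<lambda>j. f (i + j)"]) auto
  have inj: "f i \<noteq> f j" if "i < j" "j \<le> n" for i j
  proof
    assume eq: "f i = f j"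
    have "(u, f i) \<in> ?S ^^ i" "(f j, w) \<in> ?S ^^ (n - j)"
      using sub[of 0 i] sub[of j "n - j"] that f by auto
    \<comment> \<open>Cutting out the closed segment between \<open>i\<close> and \<open>j\<close>
      shortens the walk.\<close>
    then have "(u, w) \<in> ?S ^^ (i + (n - j))"
      unfolding relpow_add eq by blast
    from n(2)[OF this] that show False by simp
  qed
  have inj': "f i = f j \<longleftrightarrow> i = j" if "i \<le> n" "j \<le> n" for i j
    using inj[of i j] inj[of j i] that by (cases i j rule: linorder_cases) auto
  obtain g where g: "\<And>i. i < n \<Longrightarrow> g i \<in> F - {e} \<and> ends G (g i) = {f i, f (Suc i)}"
  proof -
    have "\<forall>i. \<exists>a. i < n \<longrightarrow> a \<in> F - {e} \<and> ends G a = {f i, f (Suc i)}"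
      using f(3) unfolding adjacency_def by blast
    then show ?thesis using that by metis
  qed
  have ginj: "i = j" if "i < n" "j < n" "g i = g j" for i j
  proof -
    have "{f i, f (Suc i)} = {f j, f (Suc j)}" using g that by metis
    \<comment> \<open>The other way for the two end sets to agree would need
      \<open>i = Suc j\<close> and \<open>j = Suc i\<close> at once.\<close>
    then show ?thesis using that inj'[of i j] inj'[of "Suc i" j] inj'[of i "Suc j"]
      by (auto simp: doubleton_eq_iff)
  qed
  let ?vs = "map f [0..<Suc n]" and ?es = "map g [0..<n] @ [e]"
  have "cycle_in G F ?vs ?es"
    unfolding cycle_in_def
  proof (intro conjI allI impI)
    show "distinct ?vs"
      unfolding distinct_map by (auto simp: inj_on_def inj' less_Suc_eq_le simp del: upt_Suc)
    show "distinct ?es"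
      using g by (force simp: distinct_map inj_on_def intro: ginj)
    show "set ?es \<subseteq> F" using g e by auto
    fix i assume i: "i < length ?es"
    show "ends G (?es ! i) = {?vs ! i, ?vs ! (Suc i mod length ?es)}"
    proof (cases "i = n")
      case True
      then show ?thesis using e(2) f(1,2) by (simp add: nth_append insert_commute del: upt_Suc)
    next
      case False
      then show ?thesis using i g[of i] by (simp add: nth_append del: upt_Suc)
    qed
  qed auto
  then show ?thesis by blast
qed

section \<open>The rooted forest of a gradient field\<close>

locale finite_multigraph =
  fixes G :: "('v, 'e) multigraph"
  assumes finite_vertices: "finite (vertices G)"
    and edge_ends: "e \<in> medges G \<Longrightarrow> \<exists>u\<in>vertices G. \<exists>v\<in>vertices G. ends G e = {u, v}"

locale gradient = finite_multigraph G for G :: "('v, 'e) multigraph" +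
  fixes A :: "('v \<times> 'e) set"
  assumes field: "gradient_field G A"
begin

lemma field_vertex: "(v, e) \<in> A \<Longrightarrow> v \<in> vertices G"
  and field_edge: "(v, e) \<in> A \<Longrightarrow> e \<in> medges G"
  and field_end: "(v, e) \<in> A \<Longrightarrow> v \<in> ends G e"
  and acyclic_descent: "acyclic (descent G A)"
  using field unfolding gradient_field_def by auto

lemma field_edge_unique: "(v, e) \<in> A \<Longrightarrow> (v, e') \<in> A \<Longrightarrow> e = e'"
  and field_vertex_unique: "(v, e) \<in> A \<Longrightarrow> (v', e) \<in> A \<Longrightarrow> v = v'"
  using field unfolding gradient_field_def inj_on_def by force+

text \<open>A matched loop would be a descent from \<open>v\<close> to itself, so acyclicity makes
  the other end a different vertex.\<close>

lemma field_descent: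
  assumes "(v, e) \<in> A"
  obtains w where "w \<in> vertices G" "ends G e = {v, w}" "(v, w) \<in> descent G A" "w \<noteq> v"
proof -
  obtain x y where xy: "x \<in> vertices G" "y \<in> vertices G" "ends G e = {x, y}"
    using edge_ends field_edge[OF assms] by blast
  then have "v = x \<or> v = y" using field_end[OF assms] by blast
  then obtain w where w: "w \<in> vertices G" "ends G e = {v, w}"
    using xy by (metis insert_commute)
  then have d: "(v, w) \<in> descent G A" using assms unfolding descent_def by blast
  moreover have "w \<noteq> v" using d acyclic_descent unfolding acyclic_def by blast
  ultimately show ?thesis using w that by blast
qed

lemma descent_vertices: "descent G A \<subseteq> vertices G \<times> vertices G"
proof (clarify)
  fix v w assume "(v, w) \<in> descent G A"
  then obtain e where e: "(v, e) \<in> A" "ends G e = {v, w}" unfolding descent_def by blast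
  then show "v \<in> vertices G \<and> w \<in> vertices G"
    using field_descent[OF e(1)] field_vertex[OF e(1)] by (metis doubleton_eq_iff)
qed

lemma descent_unique: "(v, w) \<in> descent G A \<Longrightarrow> (v, w') \<in> descent G A \<Longrightarrow> w = w'"
  unfolding descent_def by (auto simp: doubleton_eq_iff dest: field_edge_unique)

text \<open>With the converse, well-founded induction proceeds upwards from the roots, and a minimal
  element is a lowest vertex.\<close>

lemma wf_descent: "wf ((descent G A)\<inverse>)"
  using descent_vertices finite_vertices acyclic_descent
  by (meson finite_SigmaI finite_acyclic_wf_converse finite_subset)

lemma descent_adjacency: "descent G A \<subseteq> adjacency G (snd ` A)"
  unfolding descent_def adjacency_def by force

lemma descent_from_root: "r \<in> roots G A \<Longrightarrow> (r, v) \<notin> descent G A"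
  unfolding roots_def descent_def by force

lemma root_below:
  assumes "v \<in> vertices G"
  shows "\<exists>r\<in>roots G A. (v, r) \<in> (descent G A)\<^sup>*"
  using assms
proof (induction v rule: wf_induct_rule[OF wf_descent])
  case (1 v)
  show ?case
  proof (cases "v \<in> roots G A")
    case False
    then obtain e where "(v, e) \<in> A" using 1(2) unfolding roots_def by force
    then obtain w where "w \<in> vertices G" "(v, w) \<in> descent G A" by (rule field_descent)
    then show ?thesis using 1(1)[of w] by (meson converse_iff converse_rtrancl_into_rtrancl)
  qed blast
qed

lemma descent_linked: "(v, r) \<in> (descent G A)\<^sup>* \<Longrightarrow> (v, r) \<in> linked G (snd ` A)"
  using rtrancl_mono[OF descent_adjacency] unfolding linked_adjacency by blast

text \<open>Lying above \<open>r\<close> is preserved along each matched edge. Against the descent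
  this is transitivity; along it, descent is deterministic, so the path from \<open>v\<close> down
  to \<open>r\<close> must start with the same step, as a root starts none.\<close>

lemma root_below_linked:
  assumes "(u, v) \<in> linked G (snd ` A)" "(u, r) \<in> (descent G A)\<^sup>*" "r \<in> roots G A"
  shows "(v, r) \<in> (descent G A)\<^sup>*"
  using assms(1) unfolding linked_adjacency
proof (induction rule: rtrancl_induct)
  case base
  show ?case by fact
next
  case (step v w)
  then obtain x e where e: "(x, e) \<in> A" "ends G e = {v, w}" unfolding adjacency_def by force
  then consider "(v, w) \<in> descent G A" | "(w, v) \<in> descent G A"
    using field_end[OF e(1)] unfolding descent_def by (auto simp: insert_commute)
  then show ?case
  proof cases
    case 1
    then have "v \<noteq> r" using descent_from_root assms(3) by blast
    then obtain y where "(v, y) \<in> descent G A" "(y, r) \<in> (descent G A)\<^sup>*"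
      using step.IH by (meson converse_rtranclE)
    then show ?thesis using descent_unique[OF 1] by blast
  next
    case 2
    then show ?thesis using step.IH by (rule converse_rtrancl_into_rtrancl)
  qed
qed

lemma root_unique:
  assumes "(r, r') \<in> linked G (snd ` A)" "r \<in> roots G A" "r' \<in> roots G A"
  shows "r' = r"
proof -
  have "(r', r) \<in> (descent G A)\<^sup>*" using root_below_linked[OF assms(1) _ assms(2)] by blast
  then show ?thesis using descent_from_root[OF assms(3)] by (meson converse_rtranclE)
qed

lemma rooting_roots: "rooting G (snd ` A) (roots G A)"
  unfolding rooting_def
proof (intro conjI ballI)
  show "roots G A \<subseteq> vertices G" unfolding roots_def by blast
  fix C assume "C \<in> components G (snd ` A)"
  then obtain u where u: "u \<in> vertices G" "C = {v \<in> vertices G. (u, v) \<in> linked G (snd ` A)}"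
    unfolding components_def by blast
  obtain r where r: "r \<in> roots G A" "(u, r) \<in> linked G (snd ` A)"
    using root_below[OF u(1)] descent_linked by blast
  show "\<exists>!r. r \<in> roots G A \<inter> C"
  proof (rule ex1I[of _ r])
    show "r \<in> roots G A \<inter> C" using r u unfolding roots_def by blast
    fix r' assume "r' \<in> roots G A \<inter> C"
    then show "r' = r" using root_unique[of r r'] r u(2) sym_linked linked_trans by fast
  qed
qed

text \<open>A cycle has as many vertices as edges, so matching its edges with their vertices
  injectively uses up all its vertices. Hence each vertex of the cycle descends to a vertex of the
  cycle, and a lowest one cannot exist.\<close>

lemma spanning_forest_field: "spanning_forest G (snd ` A)"
  unfolding spanning_forest_def
proof (intro conjI notI)
  show "snd ` A \<subseteq> medges G" using field_edge by auto
  assume "\<exists>vs es. cycle_in G (snd ` A) vs es"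
  then obtain vs es where c: "es \<noteq> []" "length vs = length es" "distinct vs" "distinct es"
    "set es \<subseteq> snd ` A"
    "\<And>i. i < length es \<Longrightarrow> ends G (es ! i) = {vs ! i, vs ! (Suc i mod length es)}"
    unfolding cycle_in_def by blast
  let ?n = "length es"
  have "\<exists>x. (x, es ! i) \<in> A" if "i < ?n" for i
  proof -
    have "es ! i \<in> snd ` A" using c(5) nth_mem[OF that] by blast
    then show ?thesis by force
  qed
  then obtain x where x: "\<And>i. i < ?n \<Longrightarrow> (x i, es ! i) \<in> A" by metis
  have ends_vs: "ends G (es ! i) \<subseteq> set vs" if "i < ?n" for i
  proof -
    have "Suc i mod ?n < ?n" using that by (intro mod_less_divisor) linarith
    then show ?thesis using c(6)[OF that] that c(2) by (auto intro: nth_mem)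
  qed
  have x_vs: "x ` {..<?n} \<subseteq> set vs"
    using ends_vs field_end[OF x] by blast
  have "inj_on x {..<?n}"
    using field_edge_unique x c(4) by (metis inj_onI lessThan_iff nth_eq_iff_index_eq)
  then have onto: "x ` {..<?n} = set vs"
    using x_vs c(2,3) by (intro card_subset_eq) (auto simp: card_image distinct_card)
  have "vs ! 0 \<in> set vs" using c(1,2) by auto
  then obtain v where v: "v \<in> set vs" "\<And>w. (v, w) \<in> descent G A \<Longrightarrow> w \<notin> set vs"
    using wfE_min[OF wf_descent, of "vs ! 0" "set vs"] by (metis converse_iff)
  then obtain i where i: "i < ?n" "v = x i" using onto by blast
  obtain w where "ends G (es ! i) = {v, w}" "(v, w) \<in> descent G A"
    using field_descent[OF x[OF i(1)]] i(2) by metis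
  then show False using v(2) ends_vs[OF i(1)] by blast
qed

lemma card_roots: "card (roots G A) + card A = card (vertices G)"
proof -
  have sub: "fst ` A \<subseteq> vertices G" using field_vertex by auto
  have "card A = card (fst ` A)"
    using field by (simp add: gradient_field_def card_image)
  then show ?thesis
    unfolding roots_def using sub finite_vertices
    by (simp add: card_Diff_subset card_mono finite_subset)
qed

lemma roots_nonempty: "vertices G \<noteq> {} \<Longrightarrow> roots G A \<noteq> {}"
  using root_below by blast

text \<open>Each component contains exactly one root, so the roots count the components.\<close>

lemma spanning_tree_iff:
  assumes "vertices G \<noteq> {}"
  shows "spanning_tree G (snd ` A) \<longleftrightarrow> card (roots G A) = 1"
proof
  assume t: "spanning_tree G (snd ` A)"
  obtain r where r: "r \<in> roots G A" using roots_nonempty[OF assms] by blast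
  have "r' = r" if "r' \<in> roots G A" for r'
    using root_unique[OF _ r that] t r that unfolding spanning_tree_def roots_def by blast
  then have "roots G A = {r}" using r by blast
  then show "card (roots G A) = 1" by simp
next
  assume "card (roots G A) = 1"
  then obtain r where "roots G A = {r}" by (metis card_1_singletonE)
  then have "(v, r) \<in> linked G (snd ` A)" if "v \<in> vertices G" for v
    using root_below[OF that] descent_linked by auto
  then show "spanning_tree G (snd ` A)"
    unfolding spanning_tree_def using spanning_forest_field sym_linked linked_trans by metis
qed

end

section \<open>Gradient fields from rooted forests\<close>

context finite_multigraph
begin

lemma gradientI: "gradient_field G A \<Longrightarrow> gradient G A"
  by unfold_locales

text \<open>
  Where two fields with the same edges and roots differ at \<open>v\<close>, they also differ at the vertex
  below \<open>v\<close>, so that the descent would never end.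
\<close>

lemma gradient_field_subset:
  assumes A: "gradient_field G A" and B: "gradient_field G B"
    and snds: "snd ` A = snd ` B" and roots: "roots G A = roots G B"
  shows "A \<subseteq> B"
proof -
  interpret A: gradient G A by (rule gradientI[OF A])
  interpret B: gradient G B by (rule gradientI[OF B])
  have fsts: "fst ` A = fst ` B"
  proof -
    have "fst ` A \<subseteq> vertices G" "fst ` B \<subseteq> vertices G"
      using A.field_vertex B.field_vertex by auto
    then show ?thesis using roots unfolding roots_def by blast
  qed
  have eq: "e = e'" if "(v, e) \<in> A" "(v, e') \<in> B" for v e e'
    using that
  proof (induction v arbitrary: e e' rule: wf_induct_rule[OF B.wf_descent])
    case (1 v)
    obtain w where w: "ends G e' = {v, w}" "(v, w) \<in> descent G B"
      using B.field_descent[OF 1(3)] .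
    obtain x where x: "(x, e') \<in> A" using 1(3) snds by force
    show ?case
    proof (rule ccontr)
      assume ne: "e \<noteq> e'"
      then have "x \<noteq> v" using x 1(2) A.field_edge_unique by blast
      then have "x = w" using A.field_end[OF x] w(1) by blast
      \<comment> \<open>The induction hypothesis at \<open>w\<close> identifies its edges in
        \<open>A\<close> and \<open>B\<close>, so \<open>B\<close> matches \<open>e'\<close> both
        with \<open>v\<close> and with \<open>w\<close>.\<close>
      moreover obtain e'' where "(x, e'') \<in> B" using x fsts by force
      ultimately have "(v, e') \<in> B" "(w, e') \<in> B" using 1(1)[of w e' e''] w(2) x 1(3) by auto
      then have "v = w" by (rule B.field_vertex_unique)
      then show False using w(2) B.acyclic_descent unfolding acyclic_def by blast
    qed
  qed
  show ?thesis
  proof clarify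
    fix v e assume ve: "(v, e) \<in> A"
    then obtain e' where "(v, e') \<in> B" using fsts by force
    then show "(v, e) \<in> B" using eq[OF ve] by blast
  qed
qed

lemma gradient_field_eqI:
  assumes "gradient_field G A" "gradient_field G B" "snd ` A = snd ` B" "roots G A = roots G B"
  shows "A = B"
  using gradient_field_subset[of A B] gradient_field_subset[of B A] assms by simp

text \<open>Each vertex outside \<open>R\<close> is matched with the first edge of a shortest walk
  to \<open>R\<close>, so the distance to \<open>R\<close> drops with every descent.
  \<open>F\<close> may contain cycles; the field then selects a forest inside it.\<close>

lemma gradient_field_towards:
  assumes F: "F \<subseteq> medges G" and R: "R \<subseteq> vertices G"
    and reach: "\<And>v. v \<in> vertices G \<Longrightarrow> \<exists>r\<in>R. (v, r) \<in> linked G F"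
  obtains A where "gradient_field G A" "snd ` A \<subseteq> F" "roots G A = R"
proof -
  let ?S = "adjacency G F"
  define dist where "dist v = (LEAST n. \<exists>r\<in>R. (v, r) \<in> ?S ^^ n)" for v
  have "\<exists>w e. e \<in> F \<and> ends G e = {v, w} \<and> dist w < dist v" if v: "v \<in> vertices G - R" for v
  proof -
    have "\<exists>n. \<exists>r\<in>R. (v, r) \<in> ?S ^^ n"
      using reach[of v] v unfolding linked_adjacency rtrancl_is_UN_relpow by blast
    then obtain r where r: "r \<in> R" "(v, r) \<in> ?S ^^ dist v"
      using LeastI_ex[of "\<lambda>n. \<exists>r\<in>R. (v, r) \<in> ?S ^^ n"] unfolding dist_def by blast
    then obtain m where m: "dist v = Suc m" using v by (cases "dist v") auto
    then obtain w where w: "(v, w) \<in> ?S" "(w, r) \<in> ?S ^^ m" using r(2) relpow_Suc_E2 by metis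
    then have "dist w \<le> m" unfolding dist_def using r(1) by (intro Least_le) blast
    then show ?thesis using w(1) m unfolding adjacency_def by (auto simp: less_Suc_eq_le)
  qed
  then obtain nxt e where ne: "\<And>v. v \<in> vertices G - R \<Longrightarrow> e v \<in> F"
    "\<And>v. v \<in> vertices G - R \<Longrightarrow> ends G (e v) = {v, nxt v}"
    "\<And>v. v \<in> vertices G - R \<Longrightarrow> dist (nxt v) < dist v" by metis
  define A where "A = (\<lambda>v. (v, e v)) ` (vertices G - R)"
  \<comment> \<open>If two vertices shared their edge, each would be the next vertex of the other
    and thus strictly closer to \<open>R\<close>.\<close>
  have inj: "u = v" if "u \<in> vertices G - R" "v \<in> vertices G - R" "e u = e v" for u v
    using ne(2,3)[OF that(1)] ne(2,3)[OF that(2)] that(3) by (auto simp: doubleton_eq_iff)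
  have "descent G A \<subseteq> (measure dist)\<inverse>"
    using ne(2,3) unfolding descent_def A_def by (fastforce simp: doubleton_eq_iff)
  then have "acyclic (descent G A)"
    by (meson acyclic_converse acyclic_subset wf_acyclic wf_measure)
  then have "gradient_field G A"
    unfolding gradient_field_def A_def using ne(1,2) F inj by (auto simp: inj_on_def)
  moreover have "snd ` A \<subseteq> F" "roots G A = R" unfolding A_def roots_def using ne(1) R by force+
  ultimately show ?thesis using that by blast
qed

text \<open>The field directed towards the roots links the two ends of any edge of \<open>F\<close>,
  since both ends descend to the one root of their component. An edge of \<open>F\<close> left out
  by the field would therefore close a cycle in \<open>F\<close>.\<close>

lemma gradient_field_of_forest:
  assumes forest: "spanning_forest G F" and rooting: "rooting G F R"
  obtains A where "gradient_field G A" "snd ` A = F" "roots G A = R"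
proof -
  have F: "F \<subseteq> medges G" and R: "R \<subseteq> vertices G"
    using assms unfolding spanning_forest_def rooting_def by auto
  let ?C = "\<lambda>v. {w \<in> vertices G. (v, w) \<in> linked G F}"
  have one: "\<exists>!r. r \<in> R \<inter> ?C v" if "v \<in> vertices G" for v
  proof -
    have "?C v \<in> components G F" using that unfolding components_def by blast
    then show ?thesis using rooting unfolding rooting_def by (elim conjE bspec)
  qed
  have "\<exists>r\<in>R. (v, r) \<in> linked G F" if "v \<in> vertices G" for v
    using ex1_implies_ex[OF one[OF that]] by auto
  then obtain A where A: "gradient_field G A" "snd ` A \<subseteq> F" "roots G A = R"
    using gradient_field_towards[OF F R] by metis
  interpret A: gradient G A by (rule gradientI[OF A(1)])
  have "F \<subseteq> snd ` A"
  proof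
    fix e assume e: "e \<in> F"
    obtain u w where uw: "u \<in> vertices G" "w \<in> vertices G" "ends G e = {u, w}"
      using edge_ends[OF subsetD[OF F e]] by blast
    obtain r r' where r: "r \<in> R" "(u, r) \<in> linked G (snd ` A)"
      and r': "r' \<in> R" "(w, r') \<in> linked G (snd ` A)"
      using A.root_below uw A(3) A.descent_linked by meson
    have "(u, w) \<in> linked G F" using e uw(3) by (rule linked_edge)
    moreover have rF: "(u, r) \<in> linked G F" "(w, r') \<in> linked G F"
      using linked_mono[OF A(2) r(2)] linked_mono[OF A(2) r'(2)] by simp_all
    ultimately have "(u, r') \<in> linked G F" using linked_trans by metis
    then have "r \<in> R \<inter> ?C u" "r' \<in> R \<inter> ?C u" using rF(1) r(1) r'(1) R by auto
    then have "r = r'" using one[OF uw(1)] unfolding Ex1_def by metis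
    then have l: "(u, w) \<in> linked G (snd ` A)"
      using r(2) sym_linked[OF r'(2)] by (blast intro: linked_trans)
    show "e \<in> snd ` A"
    proof (rule ccontr)
      assume "e \<notin> snd ` A"
      then have "(u, w) \<in> linked G (F - {e})" using l A(2) linked_mono[of "snd ` A" "F - {e}" u w G] by blast
      then show False
        using cycle_closing_edge[OF e uw(3)] forest unfolding spanning_forest_def by blast
    qed
  qed
  then show ?thesis using A that by blast
qed

end

section \<open>The combinatorics of a projection\<close>

locale projection_map =
  fixes P :: "'d projection"
  assumes four_valent: "four_valent_map P"
begin

abbreviation rt where "rt \<equiv> rot P"
abbreviation fl where "fl \<equiv> flip P"
abbreviation opp where "opp d \<equiv> rt (rt d)"
abbreviation face_step where "face_step \<equiv> (\<lambda>d. inv (rot P) (flip P d))"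

lemma finite_darts: "finite (darts P)"
  and flip_permutes: "fl permutes darts P"
  and rot_permutes: "rt permutes darts P"
  and flip_neq: "d \<in> darts P \<Longrightarrow> fl d \<noteq> d"
  and flip_flip: "d \<in> darts P \<Longrightarrow> fl (fl d) = d"
  and card_crossing: "d \<in> darts P \<Longrightarrow> card (crossing_at P d) = 4"
  using four_valent unfolding four_valent_map_def by auto

lemma dart_maps [simp]:
  "rt d \<in> darts P \<longleftrightarrow> d \<in> darts P" "fl d \<in> darts P \<longleftrightarrow> d \<in> darts P"
  "inv rt d \<in> darts P \<longleftrightarrow> d \<in> darts P"
  using rot_permutes flip_permutes permutes_inv[OF rot_permutes] by (simp_all add: permutes_in_image)

lemma rot_inv [simp]: "inv rt (rt d) = d" "rt (inv rt d) = d"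
  using rot_permutes by (simp_all add: permutes_inverses)

lemma rot_eq_iff [simp]: "rt d = rt e \<longleftrightarrow> d = e"
  by (metis rot_inv(1))

lemma permutation_rot: "permutation rt"
  using rot_permutes finite_darts permutation_permutes by blast

lemma face_step_permutes: "face_step permutes darts P"
  using permutes_compose[OF flip_permutes permutes_inv[OF rot_permutes]] by (simp add: comp_def)

lemma permutation_face_step: "permutation face_step"
  using face_step_permutes finite_darts permutation_permutes by blast

text \<open>The size of an orbit is the least period of its points, so four darts at a crossing mean
  that \<open>rt\<close> has period exactly 4 there.\<close>

lemma rot_order: assumes "d \<in> darts P"
  shows "opp (opp d) = d" "distinct [d, rt d, opp d, rt (opp d)]"
    "crossing_at P d = {d, rt d, opp d, rt (opp d)}"
proof -
  have self: "d \<in> orbit rt d" by (rule permutation_self_in_orbit[OF permutation_rot])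
  define n where "n = (LEAST n. 0 < n \<and> (rt ^^ n) d = d)"
  have "\<exists>n. 0 < n \<and> (rt ^^ n) d = d" using self unfolding orbit_altdef by force
  from LeastI_ex[OF this] have n: "0 < n" "(rt ^^ n) d = d" unfolding n_def by auto
  have least: "n \<le> m" if "0 < m" "(rt ^^ m) d = d" for m
    unfolding n_def using that by (intro Least_le) simp
  have orb: "crossing_at P d = (\<lambda>m. (rt ^^ m) d) ` {..<n}"
    unfolding crossing_at_def orbit_altdef_bounded[OF n(2,1)] by auto
  have lt: "(rt ^^ i) d \<noteq> (rt ^^ j) d" if "i < j" "j < n" for i j
  proof
    assume eq: "(rt ^^ i) d = (rt ^^ j) d"
    have "(rt ^^ i) ((rt ^^ (j - i)) d) = (rt ^^ i) d"
      using eq that by (metis add_diff_inverse_nat comp_apply funpow_add not_less_iff_gr_or_eq)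
    moreover have "inj (rt ^^ i)" using rot_permutes permutes_inj inj_fn by blast
    ultimately have "(rt ^^ (j - i)) d = d" by (meson injD)
    then show False using least[of "j - i"] that by simp
  qed
  then have "inj_on (\<lambda>m. (rt ^^ m) d) {..<n}"
    by (intro inj_onI) (metis lessThan_iff nat_neq_iff)
  then have "n = 4" using card_crossing[OF assms] orb by (simp add: card_image)
  then show "opp (opp d) = d" using n(2) by (simp add: numeral_eq_Suc)
  have "{..<4} = {0, 1, 2, 3 :: nat}" by auto
  then show "crossing_at P d = {d, rt d, opp d, rt (opp d)}"
    using orb \<open>n = 4\<close> by (simp add: numeral_eq_Suc)
  show "distinct [d, rt d, opp d, rt (opp d)]"
    using lt[of 0 1] lt[of 0 2] lt[of 0 3] lt[of 1 2] lt[of 1 3] lt[of 2 3] \<open>n = 4\<close>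
    by (auto simp: numeral_eq_Suc)
qed

lemma opp_opp: "d \<in> darts P \<Longrightarrow> opp (opp d) = d"
  by (rule rot_order)

lemma opp_neq: "d \<in> darts P \<Longrightarrow> opp d \<noteq> d"
  using rot_order(2)[of d] by auto

lemma crossing_self: "d \<in> crossing_at P d"
  unfolding crossing_at_def by (rule permutation_self_in_orbit[OF permutation_rot])

lemma region_self: "d \<in> region_at P d"
  unfolding region_at_def by (rule permutation_self_in_orbit[OF permutation_face_step])

lemma crossing_at_eq: "e \<in> crossing_at P d \<Longrightarrow> crossing_at P e = crossing_at P d"
  unfolding crossing_at_def using orbit_cyclic_eq3[OF cyclic_on_orbit'[OF permutation_rot]] .

lemma region_at_eq: "e \<in> region_at P d \<Longrightarrow> region_at P e = region_at P d"
  unfolding region_at_def using orbit_cyclic_eq3[OF cyclic_on_orbit'[OF permutation_face_step]] .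

lemma crossing_at_rot [simp]: "crossing_at P (rt d) = crossing_at P d"
  unfolding crossing_at_def by (rule permutation_orbit_step[OF permutation_rot])

lemma crossing_at_darts: "d \<in> darts P \<Longrightarrow> crossing_at P d \<subseteq> darts P"
  unfolding crossing_at_def by (rule permutes_orbit_subset[OF rot_permutes])

lemma region_at_darts: "d \<in> darts P \<Longrightarrow> region_at P d \<subseteq> darts P"
  unfolding region_at_def by (rule permutes_orbit_subset[OF face_step_permutes])

lemma region_at_face_step [simp]: "region_at P (inv rt (fl d)) = region_at P d"
  unfolding region_at_def by (rule permutation_orbit_step[OF permutation_face_step])

lemma region_at_flip: "d \<in> darts P \<Longrightarrow> region_at P (fl d) = region_at P (inv rt d)"
  using region_at_face_step[of "fl d"] flip_flip by simp

text \<open>The corner after \<open>d\<close> lies to the right of \<open>rt d\<close>, that is, to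
  the left of the opposite dart of that edge.\<close>

lemma region_at_flip_rot: "d \<in> darts P \<Longrightarrow> region_at P (fl (rt d)) = region_at P d"
  using region_at_flip[of "rt d"] by simp

lemma crossingE: assumes "c \<in> crossings P" obtains d where "d \<in> darts P" "c = crossing_at P d"
  using assms unfolding crossings_def by blast

lemma crossing_mem: "c \<in> crossings P \<Longrightarrow> d \<in> c \<Longrightarrow> d \<in> darts P \<and> c = crossing_at P d"
  using crossingE crossing_at_eq crossing_at_darts by (metis subsetD)

lemma regionE: assumes "r \<in> regions P" obtains d where "d \<in> darts P" "r = region_at P d"
  using assms unfolding regions_def by blast

lemma finite_crossings: "finite (crossings P)"
  and finite_regions: "finite (regions P)"
  using finite_darts unfolding crossings_def regions_def by auto

text \<open>Together with the count by edges below, this makes the edges twice as many as the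
  crossings, as Euler's formula will require.\<close>

lemma card_darts_crossings: "card (darts P) = 4 * card (crossings P)"
proof -
  have "\<Union> (crossings P) = darts P"
    unfolding crossings_def using crossing_self crossing_at_darts by blast
  moreover have "card (\<Union> (crossings P)) = sum card (crossings P)"
  proof (rule card_Union_disjoint)
    show "pairwise disjnt (crossings P)"
      unfolding pairwise_def disjnt_def using crossing_mem by (metis disjoint_iff)
    show "finite c" if "c \<in> crossings P" for c
      using crossing_mem that finite_darts by (meson finite_subset subsetI)
  qed
  moreover have "card c = 4" if "c \<in> crossings P" for c
    using that card_crossing by (elim crossingE) simp
  ultimately show ?thesis by simp
qed

lemma card_darts_edges: "card (darts P) = 2 * card (edges P)"
proof -
  have "\<Union> (edges P) = darts P"
    unfolding edges_def edge_at_def by auto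
  moreover have "card (\<Union> (edges P)) = sum card (edges P)"
  proof (rule card_Union_disjoint)
    show "pairwise disjnt (edges P)"
      unfolding pairwise_def disjnt_def edges_def edge_at_def
      by (auto simp: flip_flip) (metis flip_flip)+
    show "finite c" if "c \<in> edges P" for c
      using that unfolding edges_def edge_at_def by auto
  qed
  moreover have "card c = 2" if "c \<in> edges P" for c
    using that flip_neq unfolding edges_def edge_at_def by (auto simp: card_insert_if) metis
  ultimately show ?thesis by simp
qed

end

section \<open>The graph of one colour\<close>

text \<open>
  \<open>K\<close> stands for the black or for the white regions, whose roles are symmetric up to reversing
  the poset graph.
\<close>

locale colour_class = projection_map P for P :: "'d projection" +
  fixes K :: "'d set set"
  assumes colour_regions: "K \<subseteq> regions P"
    and colour_flip: "d \<in> darts P \<Longrightarrow> region_at P d \<in> K \<longleftrightarrow> region_at P (flip P d) \<notin> K"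
begin

definition colour_graph :: "('d set, 'd set) multigraph" where
  "colour_graph = \<lparr>vertices = K, medges = crossings P, ends = (\<lambda>c. region_at P ` c \<inter> K)\<rparr>"

lemma colour_graph_simps [simp]:
  "vertices colour_graph = K" "medges colour_graph = crossings P"
  "ends colour_graph c = region_at P ` c \<inter> K"
  by (simp_all add: colour_graph_def)

text \<open>Consecutive corners at a crossing are separated by the edge of
  \<open>rt d\<close>.\<close>

lemma colour_rot: "d \<in> darts P \<Longrightarrow> region_at P (rt d) \<in> K \<longleftrightarrow> region_at P d \<notin> K"
  using colour_flip[of "rt d"] region_at_flip_rot[of d] by simp

lemma colour_opp: "d \<in> darts P \<Longrightarrow> region_at P (opp d) \<in> K \<longleftrightarrow> region_at P d \<in> K"
  using colour_rot[of d] colour_rot[of "rt d"] by simp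

text \<open>Colours alternate around a crossing, so its corners in \<open>K\<close> are
  \<open>d\<close> and \<open>opp d\<close>. The edge is a loop when both lie in one region.\<close>

lemma ends_crossing:
  assumes "d \<in> darts P" "region_at P d \<in> K"
  shows "ends colour_graph (crossing_at P d) = {region_at P d, region_at P (opp d)}"
  using assms colour_rot[of d] colour_opp[of d] colour_rot[of "opp d"] rot_order(3)[of d] by auto

lemma colour_dart_of_crossing:
  assumes "c \<in> crossings P"
  obtains d where "d \<in> darts P" "c = crossing_at P d" "region_at P d \<in> K"
proof -
  obtain d where "d \<in> darts P" "c = crossing_at P d" using assms by (rule crossingE)
  then show ?thesis using that[of d] that[of "rt d"] colour_rot[of d] by auto
qed

lemma opposite_of_corner:
  assumes "d \<in> darts P" "e \<in> crossing_at P d" "region_at P d \<in> K" "region_at P e \<in> K"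
  shows "e = d \<or> e = opp d"
  using assms colour_rot[of d] colour_rot[of "opp d"] colour_opp[of d] rot_order(3)[of d] by auto

sublocale finite_multigraph colour_graph
proof
  show "finite (vertices colour_graph)"
    using colour_regions finite_regions by (auto intro: finite_subset)
  fix c assume "c \<in> medges colour_graph"
  then obtain d where "d \<in> darts P" "c = crossing_at P d" "region_at P d \<in> K"
    using colour_dart_of_crossing by auto
  then show "\<exists>u\<in>vertices colour_graph. \<exists>v\<in>vertices colour_graph. ends colour_graph c = {u, v}"
    using ends_crossing[of d] colour_opp[of d] by auto
qed

end

section \<open>Morse matchings in one colour\<close>

text \<open>The matching condition freed from the orientation of the poset graph, so that it reads
  alike for both colours.\<close>

definition corner_matching :: "'d projection \<Rightarrow> 'd set \<Rightarrow> bool" where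
  "corner_matching P M \<longleftrightarrow> M \<subseteq> darts P \<and> inj_on (region_at P) M \<and> inj_on (crossing_at P) M"

context colour_class
begin

definition field_of :: "'d set \<Rightarrow> ('d set \<times> 'd set) set" where
  "field_of M = (\<lambda>d. (region_at P d, crossing_at P d)) ` {d \<in> M. region_at P d \<in> K}"

text \<open>
  For the black regions this is the arc relation of the poset graph with the arcs in \<open>M\<close>
  reversed, for the white regions its converse.
\<close>

definition flow :: "'d set \<Rightarrow> ('d cell \<times> 'd cell) set" where
  "flow M = {(Region (region_at P d), Crossing (crossing_at P d)) | d.
               d \<in> darts P \<and> (region_at P d \<in> K \<longleftrightarrow> d \<in> M)} \<union>
            {(Crossing (crossing_at P d), Region (region_at P d)) | d.
               d \<in> darts P \<and> (region_at P d \<in> K \<longleftrightarrow> d \<notin> M)}"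

lemma opp_notin_matching:
  assumes "corner_matching P M" "d \<in> M" shows "opp d \<notin> M"
  using assms opp_neq[of d] crossing_at_rot unfolding corner_matching_def inj_on_def
  by (metis subsetD)

lemma descent_field_of:
  assumes "M \<subseteq> darts P"
  shows "(v, w) \<in> descent colour_graph (field_of M) \<longleftrightarrow>
    (\<exists>d\<in>M. v \<in> K \<and> v = region_at P d \<and> w = region_at P (opp d))"
proof
  assume "(v, w) \<in> descent colour_graph (field_of M)"
  then obtain d where d: "d \<in> M" "v \<in> K" "v = region_at P d"
    "ends colour_graph (crossing_at P d) = {v, w}"
    unfolding descent_def field_of_def by blast
  then show "\<exists>d\<in>M. v \<in> K \<and> v = region_at P d \<and> w = region_at P (opp d)"
    using ends_crossing[of d] subsetD[OF assms d(1)] by (auto simp: doubleton_eq_iff)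
next
  assume "\<exists>d\<in>M. v \<in> K \<and> v = region_at P d \<and> w = region_at P (opp d)"
  then obtain d where d: "d \<in> M" "v \<in> K" "v = region_at P d" "w = region_at P (opp d)" by blast
  then have "ends colour_graph (crossing_at P d) = {v, w}" "(v, crossing_at P d) \<in> field_of M"
    using ends_crossing[of d] assms unfolding field_of_def by auto
  then show "(v, w) \<in> descent colour_graph (field_of M)" unfolding descent_def by blast
qed

text \<open>One descent is two steps of the flow: into the crossing at the matched corner and out at
  the opposite corner, which is unmatched because it shares the crossing.\<close>

lemma gradient_field_of_acyclic_flow:
  assumes M: "corner_matching P M" and acyc: "acyclic (flow M)"
  shows "gradient_field colour_graph (field_of M)"
  unfolding gradient_field_def
proof (intro conjI)
  have darts: "M \<subseteq> darts P" using M unfolding corner_matching_def by blast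
  show "field_of M \<subseteq> vertices colour_graph \<times> medges colour_graph"
    using subsetD[OF darts] unfolding field_of_def by (auto simp: crossings_def)
  show "\<forall>(v, e)\<in>field_of M. v \<in> ends colour_graph e"
    unfolding field_of_def by (auto intro: crossing_self)
  show "inj_on fst (field_of M)" "inj_on snd (field_of M)"
    using M unfolding corner_matching_def field_of_def inj_on_def by auto
  have "(Region v, Region w) \<in> (flow M)\<^sup>+" if "(v, w) \<in> (descent colour_graph (field_of M))\<^sup>+" for v w
    using that
  proof (induction rule: trancl_induct)
    have two: "(Region v, Region w) \<in> (flow M)\<^sup>+"
      if vw: "(v, w) \<in> descent colour_graph (field_of M)" for v w
    proof -
      obtain d where d: "d \<in> M" "v \<in> K" "v = region_at P d" "w = region_at P (opp d)"
        using vw descent_field_of[OF darts] by blast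
      have dd: "d \<in> darts P" using d darts by blast
      have "(Region v, Crossing (crossing_at P d)) \<in> flow M"
        using d dd unfolding flow_def by blast
      moreover have "(Crossing (crossing_at P (opp d)), Region w) \<in> flow M"
        using d dd opp_notin_matching[OF M d(1)] colour_opp[OF dd] unfolding flow_def
        by (intro UnI2) (auto intro!: exI[of _ "opp d"])
      ultimately show ?thesis by simp
    qed
    {
      case (base w)
      then show ?case by (rule two)
    next
      case (step w x)
      then show ?case using two[of w x] by (meson trancl_trans)
    }
  qed
  then show "acyclic (descent colour_graph (field_of M))"
    using acyc unfolding acyclic_def by blast
qed

text \<open>The flow is trapped in the colour \<open>K\<close>. It leaves a region of
  \<open>K\<close> only at a matched corner; at that crossing, leaving into the other colour would
  require a second matched corner, so only the opposite corner remains, which is a descent.\<close>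

lemma flow_from_region:
  assumes M: "corner_matching P M" and v: "v \<in> K" and flow: "(Region v, y) \<in> (flow M)\<^sup>+"
  shows "case y of
      Region w \<Rightarrow> w \<in> K \<and> (v, w) \<in> (descent colour_graph (field_of M))\<^sup>+
    | Crossing c \<Rightarrow> \<exists>u. (v, u) \<in> (descent colour_graph (field_of M))\<^sup>* \<and> (u, c) \<in> field_of M"
  using flow
proof (induction rule: trancl_induct)
  have darts: "M \<subseteq> darts P" using M unfolding corner_matching_def by blast
  have down: "\<exists>c. y = Crossing c \<and> (w, c) \<in> field_of M" if "w \<in> K" "(Region w, y) \<in> flow M" for w y
    using that unfolding flow_def field_of_def by auto
  {
    case (base y)
    then show ?case using down[OF v base] by auto
  next
    case (step y z)
    show ?case
    proof (cases y)
      case (Region w)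
      then have "w \<in> K" "(v, w) \<in> (descent colour_graph (field_of M))\<^sup>*"
        using step.IH by (auto simp: trancl_into_rtrancl)
      then show ?thesis using step(2) down[of w z] Region by auto
    next
      case (Crossing c)
      then obtain u where u: "(v, u) \<in> (descent colour_graph (field_of M))\<^sup>*" "(u, c) \<in> field_of M"
        using step by auto
      then obtain d where d: "d \<in> M" "u = region_at P d" "u \<in> K" "c = crossing_at P d"
        unfolding field_of_def by blast
      obtain e where e: "e \<in> darts P" "c = crossing_at P e" "z = Region (region_at P e)"
        "region_at P e \<in> K \<longleftrightarrow> e \<notin> M"
        using step(2) Crossing unfolding flow_def by auto
      have ne: "e \<noteq> d" using d e by auto
      then have "e \<notin> M" using M d e unfolding corner_matching_def inj_on_def by metis
      then have K: "region_at P e \<in> K" using e by blast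
      have "e \<in> crossing_at P d" using crossing_self[of e] d(4) e(2) by simp
      then have "e = opp d" using opposite_of_corner[of d e] d K ne darts by blast
      then have "(u, region_at P e) \<in> descent colour_graph (field_of M)"
        using descent_field_of[OF darts] d by blast
      then have "(v, region_at P e) \<in> (descent colour_graph (field_of M))\<^sup>+"
        using u(1) by (meson rtrancl_into_trancl1)
      then show ?thesis using e(3) K by simp
    qed
  }
qed

lemma no_flow_cycle:
  assumes "corner_matching P M" "gradient_field colour_graph (field_of M)" "v \<in> K"
  shows "(Region v, Region v) \<notin> (flow M)\<^sup>+"
  using flow_from_region[OF assms(1,3), of "Region v"] assms(2)
  unfolding gradient_field_def acyclic_def by auto

text \<open>Regions and crossings alternate along the flow, so each closed path meets a
  region.\<close>

lemma acyclic_flow_if_regions: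
  assumes "\<And>r. r \<in> regions P \<Longrightarrow> (Region r, Region r) \<notin> (flow M)\<^sup>+"
  shows "acyclic (flow M)"
  unfolding acyclic_def
proof (intro allI notI)
  fix x assume x: "(x, x) \<in> (flow M)\<^sup>+"
  then obtain y where y: "(x, y) \<in> flow M" "(y, x) \<in> (flow M)\<^sup>*" by (meson tranclD)
  have yy: "(y, y) \<in> (flow M)\<^sup>+" using y by (meson rtrancl_into_trancl1)
  have "(\<exists>r\<in>regions P. x = Region r) \<or> (\<exists>r\<in>regions P. y = Region r)"
    using y(1) unfolding flow_def regions_def by auto
  then show False using assms x yy by blast
qed

text \<open>Two corners of one crossing lie in the same region of \<open>K\<close> only if they are
  opposite and the edge is a loop, which a gradient field never matches. So a matched pair
  determines its corner.\<close>

lemma matched_corner_unique: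
  assumes M: "M \<subseteq> darts P" and grad: "gradient_field colour_graph (field_of M)"
    and d: "d \<in> darts P" "(region_at P d, crossing_at P d) \<in> field_of M"
  shows "d \<in> M"
proof -
  obtain e where e: "e \<in> M" "region_at P e = region_at P d" "crossing_at P e = crossing_at P d"
    "region_at P d \<in> K"
    using d(2) unfolding field_of_def by auto
  have "d \<noteq> opp e"
  proof
    assume "d = opp e"
    then have "(region_at P e, region_at P e) \<in> descent colour_graph (field_of M)"
      using descent_field_of[OF M] e by metis
    then show False using grad unfolding gradient_field_def acyclic_def by blast
  qed
  moreover have "d \<in> crossing_at P e" using crossing_self[of d] e(3) by simp
  ultimately show "d \<in> M" using opposite_of_corner[of e d] e M by auto
qed

lemma field_of_eq_corners:
  assumes "M \<subseteq> darts P" "gradient_field colour_graph (field_of M)"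
  shows "{d \<in> M. region_at P d \<in> K} =
    {d \<in> darts P. region_at P d \<in> K \<and> (region_at P d, crossing_at P d) \<in> field_of M}"
proof (intro set_eqI iffI)
  fix d
  assume "d \<in> {d \<in> darts P. region_at P d \<in> K \<and> (region_at P d, crossing_at P d) \<in> field_of M}"
  then show "d \<in> {d \<in> M. region_at P d \<in> K}" using matched_corner_unique[OF assms] by simp
qed (use assms(1) in \<open>auto simp: field_of_def\<close>)

definition corners_of :: "('d set \<times> 'd set) set \<Rightarrow> 'd set" where
  "corners_of A = {d \<in> darts P. (region_at P d, crossing_at P d) \<in> A}"

text \<open>\<open>corners_of\<close> inverts \<open>field_of\<close>: as \<open>A\<close> matches
  no loop, each of its pairs comes from exactly one corner.\<close>

lemma corners_of_field:
  assumes A: "gradient_field colour_graph A"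
  shows "corner_matching P (corners_of A)" "region_at P ` corners_of A \<subseteq> K"
    "field_of (corners_of A) = A"
proof -
  interpret gradient colour_graph A using A by (rule gradientI)
  show K: "region_at P ` corners_of A \<subseteq> K"
    unfolding corners_of_def using field_vertex by auto
  have inj: "d = e" if "d \<in> corners_of A" "e \<in> corners_of A"
    "region_at P d = region_at P e" "crossing_at P d = crossing_at P e" for d e
  proof (rule ccontr)
    assume "d \<noteq> e"
    have d: "d \<in> darts P" "(region_at P d, crossing_at P d) \<in> A" "region_at P d \<in> K"
      using that(1) K unfolding corners_of_def by auto
    have "e \<in> crossing_at P d" using crossing_self[of e] that(4) by simp
    then have e: "e = opp d"
      using opposite_of_corner[OF d(1) _ d(3)] d(3) that(3) \<open>d \<noteq> e\<close> by metis
    then have "ends colour_graph (crossing_at P d) = {region_at P d}"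
      using ends_crossing[OF d(1,3)] that(3) unfolding e by simp
    then show False using field_descent[OF d(2)] by (metis insertI1 insert_commute singletonD)
  qed
  show "corner_matching P (corners_of A)"
    unfolding corner_matching_def
  proof (intro conjI inj_onI)
    show "corners_of A \<subseteq> darts P" unfolding corners_of_def by blast
    fix d e assume de: "d \<in> corners_of A" "e \<in> corners_of A"
    then have A: "(region_at P d, crossing_at P d) \<in> A" "(region_at P e, crossing_at P e) \<in> A"
      unfolding corners_of_def by auto
    show "d = e" if "region_at P d = region_at P e"
      using inj[OF de] A that field_edge_unique by metis
    show "d = e" if "crossing_at P d = crossing_at P e"
      using inj[OF de] A that field_vertex_unique by metis
  qed
  show "field_of (corners_of A) = A"
  proof (intro subset_antisym subsetI)
    fix x assume "x \<in> field_of (corners_of A)"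
    then show "x \<in> A" unfolding field_of_def corners_of_def by auto
  next
    fix x assume x: "x \<in> A"
    obtain v c where [simp]: "x = (v, c)" by force
    have "v \<in> ends colour_graph c" "c \<in> crossings P" using field_end field_edge x by auto
    then obtain d where d: "d \<in> c" "v = region_at P d" "v \<in> K" by auto
    then have "d \<in> darts P" "c = crossing_at P d" using crossing_mem \<open>c \<in> crossings P\<close> by auto
    then show "x \<in> field_of (corners_of A)"
      using d x unfolding field_of_def corners_of_def by auto
  qed
qed

end

section \<open>Orthogonal spanning trees\<close>

text \<open>The set where \<open>\<chi>\<close> holds and its preimage under \<open>f\<close> have
  equal size, so \<open>\<chi>\<close> switches on along \<open>f\<close> as often as it switches
  off.\<close>

lemma even_card_changes:
  fixes \<chi> :: "'a \<Rightarrow> bool"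
  assumes f: "bij_betw f S S" and S: "finite S"
  shows "even (card {x \<in> S. \<chi> x \<noteq> \<chi> (f x)})"
proof -
  let ?X = "{x \<in> S. \<chi> x}" and ?Y = "{x \<in> S. \<chi> (f x)}"
  have inj: "inj_on f S" and img: "f ` S = S" using f by (auto simp: bij_betw_def)
  have "f ` ?Y = ?X" using img by force
  moreover have "inj_on f ?Y" using inj by (rule inj_on_subset) auto
  ultimately have "card ?X = card ?Y" by (metis card_image)
  moreover have "card (?X - ?Y) + card (?X \<inter> ?Y) = card ?X"
    using S by (subst card_Un_disjoint[symmetric]) (auto intro: arg_cong[where f = card])
  moreover have "card (?Y - ?X) + card (?X \<inter> ?Y) = card ?Y"
    using S by (subst card_Un_disjoint[symmetric]) (auto intro: arg_cong[where f = card])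
  moreover have "card {x \<in> S. \<chi> x \<noteq> \<chi> (f x)} = card (?X - ?Y) + card (?Y - ?X)"
    using S by (subst card_Un_disjoint[symmetric]) (auto intro: arg_cong[where f = card])
  ultimately show ?thesis by presburger
qed

context colour_class
begin

text \<open>For a corner in \<open>K\<close>, the two corners beside it belong to the ends of the
  dual edge. The corner is cut when that dual edge joins \<open>W\<close> to its complement.\<close>

definition cut_corner :: "'d set set \<Rightarrow> 'd \<Rightarrow> bool" where
  "cut_corner W d \<longleftrightarrow> (region_at P (inv rt d) \<in> W) \<noteq> (region_at P (rt d) \<in> W)"

lemma cut_corner_opp: "d \<in> darts P \<Longrightarrow> cut_corner W (opp d) \<longleftrightarrow> cut_corner W d"
  using opp_opp[of "inv rt d"] unfolding cut_corner_def by auto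

text \<open>
  Walking around a region, one crosses from \<open>W\<close> to its complement as often as back.
\<close>

lemma even_cut_corners:
  assumes "v \<in> regions P"
  shows "even (card {d \<in> v. cut_corner W d})"
proof -
  obtain a where a: "a \<in> darts P" "v = region_at P a" using assms by (rule regionE)
  have v: "v \<subseteq> darts P" "finite v" using a region_at_darts finite_darts finite_subset by metis+
  have "cyclic_on face_step v"
    unfolding a(2) region_at_def by (rule cyclic_on_orbit'[OF permutation_face_step])
  then have "face_step ` v \<subseteq> v" using cyclic_on_inI by fast
  moreover have inj: "inj_on face_step v"
    using permutes_inj[OF face_step_permutes] by (rule inj_on_subset) simp
  ultimately have bij: "bij_betw face_step v v"
    using v(2) by (simp add: bij_betw_def endo_inj_surj)
  \<comment> \<open>This records whether the region across the edge of \<open>d\<close> lies in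
    \<open>W\<close>; the corner between two consecutive boundary edges is cut when the value
    changes.\<close>
  let ?\<chi> = "\<lambda>d. region_at P (fl d) \<in> W"
  have step: "cut_corner W (face_step d) \<longleftrightarrow> ?\<chi> d \<noteq> ?\<chi> (face_step d)" if "d \<in> v" for d
    using that v region_at_flip[of "face_step d"] unfolding cut_corner_def by auto
  let ?D = "{d \<in> v. ?\<chi> d \<noteq> ?\<chi> (face_step d)}"
  have img: "face_step ` ?D = {d \<in> v. cut_corner W d}"
  proof (intro subset_antisym subsetI)
    fix e assume "e \<in> {d \<in> v. cut_corner W d}"
    then obtain d where "d \<in> v" "e = face_step d" "cut_corner W e"
      using bij unfolding bij_betw_def by blast
    then show "e \<in> face_step ` ?D"
      using step by blast
  next
    fix e assume "e \<in> face_step ` ?D"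
    then show "e \<in> {d \<in> v. cut_corner W d}"
      using bij step unfolding bij_betw_def by auto
  qed
  have "inj_on face_step ?D"
    using inj by (rule inj_on_subset) auto
  then have "card {d \<in> v. cut_corner W d} = card ?D"
    unfolding img[symmetric] by (rule card_image)
  then show ?thesis using even_card_changes[OF bij v(2), of ?\<chi>] by (simp only:)
qed

text \<open>
  Otherwise take a matched vertex, as high as possible, whose edge is a cut crossing: the other
  cut corners there would belong to edges descending into it from a higher such vertex, so it has
  a single cut corner, against parity.
\<close>

lemma cut_crossing_outside_field:
  assumes A: "gradient_field colour_graph A"
    and d: "d \<in> darts P" "region_at P d \<in> K" "cut_corner W d"
  obtains (outside) e where "e \<in> darts P" "region_at P e \<in> K" "cut_corner W e" "crossing_at P e \<notin> snd ` A"
proof (rule ccontr)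
  assume none: "\<not> thesis"
  have cut_in: "\<exists>v. (v, crossing_at P e) \<in> A"
    if "e \<in> darts P" "region_at P e \<in> K" "cut_corner W e" for e
    using none outside that by force
  interpret gradient colour_graph A using A by (rule gradientI)
  \<comment> \<open>The orientation is opposite to that of \<open>wf_descent\<close>, so a minimal
    element of \<open>Q\<close> is a highest one.\<close>
  have wf: "wf (descent colour_graph A)"
    using descent_vertices finite_vertices acyclic_descent
    by (meson finite_SigmaI finite_acyclic_wf finite_subset)
  define Q where
    "Q = {v. \<exists>e. (v, crossing_at P e) \<in> A \<and> e \<in> darts P \<and> region_at P e \<in> K \<and> cut_corner W e}"
  obtain v0 where "v0 \<in> Q" using cut_in[OF d] d unfolding Q_def by blast
  then obtain v where v: "v \<in> Q" "\<And>u. (u, v) \<in> descent colour_graph A \<Longrightarrow> u \<notin> Q"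
    using wfE_min[OF wf] by metis
  obtain e where e: "(v, crossing_at P e) \<in> A" "e \<in> darts P" "region_at P e \<in> K" "cut_corner W e"
    using v(1) unfolding Q_def by blast
  have "v \<in> {region_at P e, region_at P (opp e)}"
    using field_end[OF e(1)] unfolding ends_crossing[OF e(2,3)] .
  \<comment> \<open>Of the two opposite corners of this crossing, both cut, \<open>f\<close> is the
    one in the region \<open>v\<close> matched with it.\<close>
  then obtain f where f0: "f \<in> {e, opp e}" "region_at P f = v" by blast
  then have f: "f \<in> darts P" "region_at P f = v" "v \<in> K" "cut_corner W f"
    "crossing_at P f = crossing_at P e"
    using e cut_corner_opp[OF e(2)] colour_opp[OF e(2)] by auto
  obtain w where w: "ends colour_graph (crossing_at P f) = {v, w}" "w \<noteq> v"
    using field_descent[OF e(1)] f(5) by metis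
  have "g = f" if g: "g \<in> v" "cut_corner W g" for g
  proof -
    have gd: "g \<in> darts P" "region_at P g = v"
      using g f region_at_darts region_at_eq by auto
    obtain u where u: "(u, crossing_at P g) \<in> A" using cut_in[of g] gd g f(3) by auto
    have "u = v"
    proof (rule ccontr)
      assume ne: "u \<noteq> v"
      have ends: "ends colour_graph (crossing_at P g) = {v, region_at P (opp g)}"
        using ends_crossing[OF gd(1)] gd(2) f(3) by metis
      have "u = region_at P (opp g)" using field_end[OF u] ne unfolding ends by blast
      then have "ends colour_graph (crossing_at P g) = {u, v}"
        unfolding ends by (simp only: insert_commute)
      then have "(u, v) \<in> descent colour_graph A" using u unfolding descent_def by blast
      moreover have "u \<in> Q" using u gd g f(3) unfolding Q_def by blast
      ultimately show False using v(2) by blast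
    qed
    then have "crossing_at P g = crossing_at P f" using u e(1) f(5) field_edge_unique by metis
    then have "g = f \<or> g = opp f"
      using opposite_of_corner[of f g] crossing_self[of g] f gd by auto
    moreover have "region_at P (opp f) \<noteq> v"
      using ends_crossing[of f] f w by (metis doubleton_eq_iff)
    ultimately show "g = f" using gd by auto
  qed
  moreover have "f \<in> v" using f(2) region_self[of f] by simp
  ultimately have "{g \<in> v. cut_corner W g} = {f}" using f(4) by blast
  moreover have "v \<in> regions P" using f(1,2) unfolding regions_def by blast
  ultimately show False using even_cut_corners[of v W] by simp
qed

text \<open>A path of darts is pushed to the regions of \<open>K\<close> beside their edges:
  \<open>side\<close> is constant under \<open>flip\<close>, and under \<open>rot\<close> it either
  stays or passes through the crossing.\<close>

lemma regions_linked:
  assumes conn: "connected_map P" and "u \<in> K" "v \<in> K"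
  shows "(u, v) \<in> linked colour_graph (crossings P)"
proof -
  define side where "side d = (if region_at P d \<in> K then region_at P d else region_at P (fl d))" for d
  obtain a b where ab: "a \<in> darts P" "u = region_at P a" "b \<in> darts P" "v = region_at P b"
    using assms(2,3) colour_regions by (meson regionE subsetD)
  have "(a, b) \<in> {(x, y). y = fl x \<or> y = rt x}\<^sup>*"
    using conn ab unfolding connected_map_def by blast
  then have "(side a, side b) \<in> linked colour_graph (crossings P) \<and> b \<in> darts P"
  proof (induction rule: rtrancl_induct)
    case base
    then show ?case using ab linked_refl by auto
  next
    case (step x y)
    have x: "x \<in> darts P" using step by blast
    have "(side x, side y) \<in> linked colour_graph (crossings P)"
    proof (cases "y = fl x")
      case True
      then have "side y = side x" using colour_flip[OF x] flip_flip[OF x] unfolding side_def by auto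
      then show ?thesis by (simp add: linked_refl)
    next
      case False
      then have y: "y = rt x" using step by blast
      show ?thesis
      proof (cases "region_at P x \<in> K")
        case True
        then have "side y = side x"
          using y colour_rot[OF x] region_at_flip_rot[OF x] unfolding side_def by auto
        then show ?thesis by (simp add: linked_refl)
      next
        case F: False
        \<comment> \<open>The corner of \<open>x\<close> has the other colour, so
          \<open>side\<close> moves from the corner before it to the corner after it. These are
          opposite corners and hence the ends of the crossing.\<close>
        let ?z = "inv rt x"
        have z: "?z \<in> darts P" "region_at P ?z \<in> K" using x F colour_rot[of ?z] by auto
        have "side x = region_at P ?z" "side y = region_at P (opp ?z)"
          using y F colour_rot[OF x] region_at_flip[OF x] unfolding side_def by auto
        moreover have "crossing_at P ?z \<in> crossings P" using z unfolding crossings_def by blast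
        ultimately show ?thesis using ends_crossing[OF z] by (metis linked_edge)
      qed
    qed
    then show ?case using step x linked_trans by fastforce
  qed
  then show ?thesis using ab assms(2,3) unfolding side_def by simp
qed

end

section \<open>Both colours of a knot projection\<close>

locale knot_map =
  fixes P :: "'d projection"
  assumes knot: "knot_projection P"

sublocale knot_map \<subseteq> projection_map P
  using knot by unfold_locales (simp add: knot_projection_def)

sublocale knot_map \<subseteq> black: colour_class P "black P"
  using knot unfolding knot_projection_def chequerboard_def by unfold_locales blast+

sublocale knot_map \<subseteq> white: colour_class P "white P"
proof
  show "white P \<subseteq> regions P" unfolding white_def by blast
  fix d assume "d \<in> darts P"
  then show "region_at P d \<in> white P \<longleftrightarrow> region_at P (flip P d) \<notin> white P"
    using black.colour_flip[of d] unfolding white_def regions_def by auto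
qed

context knot_map
begin

lemma connected: "connected_map P"
  and darts_nonempty: "darts P \<noteq> {}"
  using knot unfolding knot_projection_def by auto

lemma white_iff: "d \<in> darts P \<Longrightarrow> region_at P d \<in> white P \<longleftrightarrow> region_at P d \<notin> black P"
  unfolding white_def regions_def by blast

lemma colour_graphs: "black.colour_graph = black_graph P" "white.colour_graph = white_graph P"
  by (simp_all add: black.colour_graph_def white.colour_graph_def black_graph_def white_graph_def)

lemma both_colours: "black P \<noteq> {}" "white P \<noteq> {}"
  using darts_nonempty black.colour_flip white.colour_flip by blast+

lemma black_white: "black P \<union> white P = regions P" "black P \<inter> white P = {}"
  using black.colour_regions unfolding white_def by auto

lemma finite_colours: "finite (black P)" "finite (white P)"
  using black.finite_vertices white.finite_vertices by simp_all

text \<open>With twice as many edges as crossings, the Euler characteristic 2 leaves two more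
  regions than crossings.\<close>

lemma euler: "card (black P) + card (white P) = card (crossings P) + 2"
proof -
  have "card (regions P) = card (black P) + card (white P)"
    using card_Un_disjoint[OF finite_colours black_white(2)] black_white(1) by simp
  moreover have "spherical P" using knot unfolding knot_projection_def by blast
  ultimately show ?thesis
    using card_darts_crossings card_darts_edges unfolding spherical_def by linarith
qed

text \<open>Let \<open>W\<close> be the white component of \<open>u\<close>. If it missed
  \<open>v\<close>, connectedness of the white graph would give a crossing cut by \<open>W\<close>,
  and parity then a cut crossing outside the black field. The white edge there is available and
  leaves \<open>W\<close>, a contradiction.\<close>

lemma white_linked_off_black_field:
  assumes A: "gradient_field black.colour_graph A" and uv: "u \<in> white P" "v \<in> white P"
  shows "(u, v) \<in> linked white.colour_graph (crossings P - snd ` A)"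
proof (rule ccontr)
  let ?L = "linked white.colour_graph (crossings P - snd ` A)"
  assume not: "(u, v) \<notin> ?L"
  define W where "W = {x. (u, x) \<in> ?L}"
  have "(u, v) \<in> linked white.colour_graph (crossings P)"
    using white.regions_linked[OF connected uv] .
  then have "\<exists>x y. (x, y) \<in> adjacency white.colour_graph (crossings P) \<and> x \<in> W \<and> y \<notin> W"
  proof (rule contrapos_pp)
    assume none: "\<not> (\<exists>x y. (x, y) \<in> adjacency white.colour_graph (crossings P) \<and> x \<in> W \<and> y \<notin> W)"
    have "y \<in> W" if "(u, y) \<in> (adjacency white.colour_graph (crossings P))\<^sup>*" for y
      using that none by induction (auto simp: W_def linked_refl)
    then show "(u, v) \<notin> linked white.colour_graph (crossings P)"
      using not unfolding W_def linked_adjacency by blast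
  qed
  then obtain x y c where xy: "x \<in> W" "y \<notin> W" "c \<in> crossings P" "ends white.colour_graph c = {x, y}"
    unfolding adjacency_def by blast
  obtain d where d: "d \<in> darts P" "c = crossing_at P d" "region_at P d \<in> black P"
    using black.colour_dart_of_crossing[OF xy(3)] .
  have white_ends: "ends white.colour_graph (crossing_at P e) = {region_at P (inv rt e), region_at P (rt e)}"
    if "e \<in> darts P" "region_at P e \<in> black P" for e
  proof -
    have "region_at P (inv rt e) \<in> white P"
      using that white_iff[of e] white.colour_rot[of "inv rt e"] by auto
    then show ?thesis
      using white.ends_crossing[of "inv rt e"] that crossing_at_rot[of "inv rt e"] by simp
  qed
  have "black.cut_corner W d"
    using white_ends[OF d(1,3)] xy d(2) unfolding black.cut_corner_def
    by (auto simp: doubleton_eq_iff)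
  then obtain e where e: "e \<in> darts P" "region_at P e \<in> black P" "black.cut_corner W e"
    "crossing_at P e \<notin> snd ` A"
    using black.cut_crossing_outside_field[OF A d(1,3)] by blast
  have "crossing_at P e \<in> crossings P - snd ` A" using e unfolding crossings_def by blast
  then have l: "(region_at P (inv rt e), region_at P (rt e)) \<in> ?L"
    using white_ends[OF e(1,2)] by (rule linked_edge)
  have "region_at P (inv rt e) \<in> W \<longleftrightarrow> region_at P (rt e) \<in> W"
    unfolding W_def using linked_trans[OF _ l] linked_trans[OF _ sym_linked[OF l]] by blast
  then show False using e(3) unfolding black.cut_corner_def by blast
qed

text \<open>The black tree is chosen first, the white one among the crossings it leaves free. The
  pair witnesses that two critical cells can be attained.\<close>

lemma orthogonal_spanning_tree_fields:
  obtains A B r s where "gradient_field black.colour_graph A" "roots black.colour_graph A = {r}"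
    "gradient_field white.colour_graph B" "roots white.colour_graph B = {s}"
    "snd ` A \<inter> snd ` B = {}"
proof -
  obtain r s where rs: "r \<in> black P" "s \<in> white P" using both_colours by blast
  obtain A where A: "gradient_field black.colour_graph A" "roots black.colour_graph A = {r}"
  proof (rule black.gradient_field_towards[of "crossings P" "{r}"])
    show "\<exists>q\<in>{r}. (v, q) \<in> linked black.colour_graph (crossings P)"
      if "v \<in> vertices black.colour_graph" for v
      using black.regions_linked[OF connected _ rs(1)] that by simp
  qed (use rs in simp_all)
  obtain B where B: "gradient_field white.colour_graph B" "roots white.colour_graph B = {s}"
    "snd ` B \<subseteq> crossings P - snd ` A"
  proof (rule white.gradient_field_towards[of "crossings P - snd ` A" "{s}"])
    show "\<exists>q\<in>{s}. (v, q) \<in> linked white.colour_graph (crossings P - snd ` A)"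
      if "v \<in> vertices white.colour_graph" for v
      using white_linked_off_black_field[OF A(1) _ rs(2)] that by simp
  qed (use rs in auto)
  show ?thesis using that[OF A B(1,2)] B(3) by blast
qed

end

section \<open>The bijection\<close>

text \<open>A nonempty closed walk contains a cycle, so cycles of arcs can be detected in the
  relation on vertices, parallel arcs included.\<close>

lemma (in wf_digraph) ex_cycle_iff: "(\<exists>p. cycle p) \<longleftrightarrow> \<not> acyclic (arcs_ends G)"
proof
  assume "\<exists>p. cycle p"
  then obtain u p where "awalk u p u" "p \<noteq> []" unfolding cycle_def by blast
  then have "(u, u) \<in> (arcs_ends G)\<^sup>+" using reachable1_awalk by blast
  then show "\<not> acyclic (arcs_ends G)" unfolding acyclic_def by blast
next
  assume "\<not> acyclic (arcs_ends G)"
  then obtain u where "(u, u) \<in> (arcs_ends G)\<^sup>+" unfolding acyclic_def by blast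
  then obtain p where "awalk u p u" "p \<noteq> []" using reachable1_awalk by blast
  then show "\<exists>p. cycle p" using closed_w_imp_cycle unfolding closed_w_def by blast
qed

context knot_map
begin

lemma matching_iff: "matching (poset_graph P) M \<longleftrightarrow> corner_matching P M"
proof -
  have "{tail (poset_graph P) d, head (poset_graph P) d} =
      {Region (region_at P d), Crossing (crossing_at P d)}" for d
    by (auto simp: poset_graph_def)
  moreover have "arcs (poset_graph P) = darts P" by (simp add: poset_graph_def)
  ultimately show ?thesis
    unfolding matching_def corner_matching_def inj_on_def by auto
qed

lemma wf_digraph_reverse_arcs: "wf_digraph (reverse_arcs (poset_graph P) M)"
  by unfold_locales (auto simp: reverse_arcs_def poset_graph_def regions_def crossings_def)

lemma arcs_ends_reverse_arcs: "arcs_ends (reverse_arcs (poset_graph P) M) = black.flow M"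
proof -
  have "arc_to_ends (reverse_arcs (poset_graph P) M) =
    (\<lambda>d. if region_at P d \<in> black P \<longleftrightarrow> d \<in> M
         then (Region (region_at P d), Crossing (crossing_at P d))
         else (Crossing (crossing_at P d), Region (region_at P d)))" (is "_ = ?f")
    by (auto simp: fun_eq_iff arc_to_ends_def reverse_arcs_def poset_graph_def)
  moreover have "arcs (reverse_arcs (poset_graph P) M) = darts P"
    by (simp add: reverse_arcs_def poset_graph_def)
  moreover have "?f ` darts P = black.flow M"
    unfolding black.flow_def by (auto simp: image_iff)
  ultimately show ?thesis unfolding arcs_ends_def by simp
qed

lemma white_flow: "white.flow M = (black.flow M)\<inverse>"
  unfolding white.flow_def black.flow_def using white_iff by blast

text \<open>A closed path of the flow stays in one colour. For a white region the path is read
  backwards, as the white flow is the converse of the black one.\<close>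

lemma discrete_morse_iff:
  "discrete_morse P M \<longleftrightarrow> corner_matching P M \<and>
     gradient_field black.colour_graph (black.field_of M) \<and>
     gradient_field white.colour_graph (white.field_of M)"
proof -
  have "discrete_morse P M \<longleftrightarrow> corner_matching P M \<and> acyclic (black.flow M)"
    unfolding discrete_morse_def matching_iff
    using wf_digraph.ex_cycle_iff[OF wf_digraph_reverse_arcs[of M]] arcs_ends_reverse_arcs[of M] by simp
  moreover have "acyclic (black.flow M)"
    if M: "corner_matching P M" "gradient_field black.colour_graph (black.field_of M)"
      "gradient_field white.colour_graph (white.field_of M)"
  proof (rule black.acyclic_flow_if_regions)
    fix r assume "r \<in> regions P"
    then consider "r \<in> black P" | "r \<in> white P" using black_white(1) by blast
    then show "(Region r, Region r) \<notin> (black.flow M)\<^sup>+"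
    proof cases
      case 1
      then show ?thesis by (rule black.no_flow_cycle[OF M(1,2)])
    next
      case 2
      then have "(Region r, Region r) \<notin> (white.flow M)\<^sup>+" by (rule white.no_flow_cycle[OF M(1,3)])
      then show ?thesis unfolding white_flow trancl_converse by simp
    qed
  qed
  moreover have "acyclic (white.flow M)" if "acyclic (black.flow M)"
    using that unfolding white_flow by simp
  ultimately show ?thesis
    using black.gradient_field_of_acyclic_flow white.gradient_field_of_acyclic_flow by blast
qed

end

section \<open>Counting critical cells\<close>

locale morse_map = knot_map P for P :: "'d projection" +
  fixes M :: "'d set"
  assumes morse: "discrete_morse P M"
begin

lemma matching: "corner_matching P M"
  and darts: "M \<subseteq> darts P"
  and inj_region: "inj_on (region_at P) M"
  and inj_crossing: "inj_on (crossing_at P) M"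
  using morse unfolding discrete_morse_iff corner_matching_def by auto

end

sublocale morse_map \<subseteq> bgrad: gradient black.colour_graph "black.field_of M"
  using morse unfolding discrete_morse_iff by unfold_locales blast

sublocale morse_map \<subseteq> wgrad: gradient white.colour_graph "white.field_of M"
  using morse unfolding discrete_morse_iff by unfold_locales blast

context morse_map
begin

abbreviation black_roots where "black_roots \<equiv> roots black.colour_graph (black.field_of M)"
abbreviation white_roots where "white_roots \<equiv> roots white.colour_graph (white.field_of M)"

lemma M_split: "M = {d \<in> M. region_at P d \<in> black P} \<union> {d \<in> M. region_at P d \<in> white P}"
  using white_iff darts by blast

lemma roots_unmatched:
  "black_roots = black P - region_at P ` M" "white_roots = white P - region_at P ` M"
  unfolding roots_def black.field_of_def white.field_of_def by (auto simp: image_image)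

lemma crossings_split:
  "snd ` black.field_of M = crossing_at P ` {d \<in> M. region_at P d \<in> black P}"
  "snd ` white.field_of M = crossing_at P ` {d \<in> M. region_at P d \<in> white P}"
  unfolding black.field_of_def white.field_of_def by (simp_all add: image_image)

lemma edges_disjoint: "snd ` black.field_of M \<inter> snd ` white.field_of M = {}"
proof -
  have "{d \<in> M. region_at P d \<in> black P} \<inter> {d \<in> M. region_at P d \<in> white P} = {}"
    using black_white(2) by blast
  then show ?thesis
    unfolding crossings_split using inj_on_image_Int[OF inj_crossing] by (metis (no_types, lifting)
      Collect_subset image_empty mem_Collect_eq subsetI)
qed

lemma finite_M: "finite M"
  using darts finite_darts by (rule finite_subset)

text \<open>Every region is either a root or matched by exactly one corner of \<open>M\<close>, and
  Euler's formula gives the number of regions.\<close>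

lemma card_M: "card M + card black_roots + card white_roots = card (crossings P) + 2"
proof -
  have "card (black.field_of M) = card {d \<in> M. region_at P d \<in> black P}"
    "card (white.field_of M) = card {d \<in> M. region_at P d \<in> white P}"
    unfolding black.field_of_def white.field_of_def
    using inj_region by (auto intro!: card_image simp: inj_on_def)
  moreover have "card M = card {d \<in> M. region_at P d \<in> black P} + card {d \<in> M. region_at P d \<in> white P}"
    by (subst M_split, rule card_Un_disjoint) (use finite_M black_white(2) in auto)
  ultimately show ?thesis
    using bgrad.card_roots wgrad.card_roots euler by simp
qed

lemma roots_pos: "0 < card black_roots" "0 < card white_roots"
proof -
  have "finite black_roots" "finite white_roots"
    using finite_colours unfolding roots_def by auto
  then show "0 < card black_roots" "0 < card white_roots"
    using bgrad.roots_nonempty wgrad.roots_nonempty both_colours by (simp_all add: card_gt_0_iff)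
qed

lemma crossing_image: "crossing_at P ` M \<subseteq> crossings P" "card (crossing_at P ` M) = card M"
  using darts inj_crossing unfolding crossings_def by (auto simp: card_image)

text \<open>Besides the roots, the unmatched crossings are critical, and by \<open>card_M\<close>
  there are two fewer of them than roots.\<close>

lemma card_critical_cells:
  "card (critical_cells P M) + 2 = 2 * (card black_roots + card white_roots)"
proof -
  have crit: "critical_cells P M =
    (Region ` black_roots \<union> Region ` white_roots) \<union> Crossing ` (crossings P - crossing_at P ` M)"
  proof -
    have "tail (poset_graph P) ` M \<union> head (poset_graph P) ` M =
        Region ` region_at P ` M \<union> Crossing ` crossing_at P ` M"
      unfolding poset_graph_def by (auto simp: image_iff split: if_splits)
    moreover have "verts (poset_graph P) = Region ` (black P \<union> white P) \<union> Crossing ` crossings P"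
      unfolding poset_graph_def black_white by simp
    ultimately show ?thesis
      unfolding critical_cells_def roots_unmatched by auto
  qed
  have fin: "finite black_roots" "finite white_roots" "finite (crossings P - crossing_at P ` M)"
    using roots_pos finite_crossings card_gt_0_iff by blast+
  have disj: "black_roots \<inter> white_roots = {}"
    unfolding roots_unmatched using black_white(2) by blast
  have "card (critical_cells P M) =
      card (Region ` (black_roots \<union> white_roots)) + card (Crossing ` (crossings P - crossing_at P ` M))"
    unfolding crit image_Un[symmetric] using fin by (intro card_Un_disjoint) auto
  also have "\<dots> = card (black_roots \<union> white_roots) + card (crossings P - crossing_at P ` M)"
    by (simp add: card_image inj_on_def)
  also have "card (black_roots \<union> white_roots) = card black_roots + card white_roots"
    using card_Un_disjoint[OF fin(1,2) disj] .
  also have "card (crossings P - crossing_at P ` M) = card (crossings P) - card M"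
    using crossing_image finite_M by (simp add: card_Diff_subset)
  finally have "card (critical_cells P M) = card black_roots + card white_roots + (card (crossings P) - card M)" .
  moreover have "card M \<le> card (crossings P)"
    using card_mono[OF finite_crossings crossing_image(1)] crossing_image(2) by simp
  ultimately show ?thesis using card_M by simp
qed

lemma maximal_iff: "crossing_at P ` M = crossings P \<longleftrightarrow> card black_roots = 1 \<and> card white_roots = 1"
proof -
  have "crossing_at P ` M = crossings P \<longleftrightarrow> card M = card (crossings P)"
    using crossing_image finite_crossings card_subset_eq by metis
  then show ?thesis using card_M roots_pos by linarith
qed

text \<open>The state sends a crossing to the region of the corner of \<open>M\<close> there, which
  injectivity on crossings makes unique. Acyclicity leaves a root of each colour, and this is
  admissibility.\<close>

lemma state_of_matching:
  defines "s \<equiv> \<lambda>c. if c \<in> crossing_at P ` M then Some (region_at P (the_inv_into M (crossing_at P) c)) else None"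
  shows "partial_kauffman_state P s" "admissible P s" "matching_of_state P s M"
    "dom s = crossing_at P ` M"
proof -
  have s: "s (crossing_at P d) = Some (region_at P d)" if "d \<in> M" for d
    unfolding s_def using that the_inv_into_f_f[OF inj_crossing that] by simp
  have sE: "\<exists>d\<in>M. c = crossing_at P d \<and> r = region_at P d" if "s c = Some r" for c r
  proof -
    have "c \<in> crossing_at P ` M" using that unfolding s_def by (auto split: if_splits)
    then show ?thesis using s that by auto
  qed
  show dom: "dom s = crossing_at P ` M" unfolding s_def dom_def by auto
  have ran: "ran s = region_at P ` M"
  proof (intro subset_antisym subsetI)
    fix r assume "r \<in> ran s"
    then show "r \<in> region_at P ` M" using sE unfolding ran_def by blast
  next
    fix r assume "r \<in> region_at P ` M"
    then show "r \<in> ran s" using s unfolding ran_def by blast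
  qed
  show "matching_of_state P s M"
    unfolding matching_of_state_def dom using darts s inj_crossing by (auto intro: inj_on_imp_bij_betw)
  show "admissible P s"
    using roots_pos unfolding admissible_def ran roots_unmatched by (auto simp: card_gt_0_iff)
  have "inj_on s (dom s)"
    unfolding dom inj_on_def using s inj_region by (auto simp: inj_on_def)
  moreover have "r \<in> region_at P ` c" if "s c = Some r" for c r
    using sE[OF that] crossing_self by auto
  ultimately show "partial_kauffman_state P s"
    unfolding partial_kauffman_state_def using crossing_image(1) dom by simp
qed

end

section \<open>From Morse matchings to rooted orthogonal forests and trees\<close>

context knot_map
begin

lemma morse_mapI: "discrete_morse P M \<Longrightarrow> morse_map P M"
  by unfold_locales

lemma admissible_morse_eq: "admissible_morse P = {M. discrete_morse P M}"
proof -
  have "\<exists>s. partial_kauffman_state P s \<and> admissible P s \<and> matching_of_state P s M"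
    if "discrete_morse P M" for M
    using morse_map.state_of_matching(1-3)[OF morse_mapI[OF that]] by (intro exI conjI)
  then show ?thesis unfolding admissible_morse_def by blast
qed

lemma maximal_admissible_morse_eq:
  "maximal_admissible_morse P = {M. discrete_morse P M \<and> crossing_at P ` M = crossings P}"
proof (intro subset_antisym subsetI)
  fix M assume "M \<in> maximal_admissible_morse P"
  then show "M \<in> {M. discrete_morse P M \<and> crossing_at P ` M = crossings P}"
    unfolding maximal_admissible_morse_def maximal_state_def matching_of_state_def bij_betw_def by auto
next
  fix M assume M: "M \<in> {M. discrete_morse P M \<and> crossing_at P ` M = crossings P}"
  then interpret morse_map P M by unfold_locales simp
  have "\<exists>s. partial_kauffman_state P s \<and> admissible P s \<and> dom s = crossings P \<and> matching_of_state P s M"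
    using state_of_matching M by (intro exI conjI) auto
  then show "M \<in> maximal_admissible_morse P"
    using morse unfolding maximal_admissible_morse_def maximal_state_def by blast
qed

text \<open>Corners of different colours never share a region, and disjointness of the edge sets
  keeps them from sharing a crossing.\<close>

lemma morse_of_fields:
  assumes A: "gradient_field black.colour_graph A" and B: "gradient_field white.colour_graph B"
    and AB: "snd ` A \<inter> snd ` B = {}"
  obtains M where "discrete_morse P M" "black.field_of M = A" "white.field_of M = B"
proof -
  let ?M = "black.corners_of A" and ?N = "white.corners_of B"
  note a = black.corners_of_field[OF A] and b = white.corners_of_field[OF B]
  have fA: "black.field_of (?M \<union> ?N) = A"
  proof -
    have "black.field_of (?M \<union> ?N) = black.field_of ?M"
      unfolding black.field_of_def using b(2) black_white(2) by blast
    then show ?thesis using a(3) by simp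
  qed
  have fB: "white.field_of (?M \<union> ?N) = B"
  proof -
    have "white.field_of (?M \<union> ?N) = white.field_of ?N"
      unfolding white.field_of_def using a(2) black_white(2) by blast
    then show ?thesis using b(3) by simp
  qed
  have "corner_matching P (?M \<union> ?N)"
    unfolding corner_matching_def inj_on_Un
  proof (intro conjI)
    show "region_at P ` (?M - ?N) \<inter> region_at P ` (?N - ?M) = {}"
      using a(2) b(2) black_white(2) by blast
    have "crossing_at P ` ?M \<subseteq> snd ` A" "crossing_at P ` ?N \<subseteq> snd ` B"
      unfolding black.corners_of_def white.corners_of_def by force+
    then show "crossing_at P ` (?M - ?N) \<inter> crossing_at P ` (?N - ?M) = {}"
      using AB by (meson Diff_subset disjoint_iff image_mono subset_iff)
  qed (use a(1) b(1) in \<open>auto simp: corner_matching_def\<close>)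
  then show ?thesis using that[of "?M \<union> ?N"] fA fB A B unfolding discrete_morse_iff by simp
qed

definition forests_of :: "'d set \<Rightarrow> 'd rooted_subgraph \<times> 'd rooted_subgraph" where
  "forests_of M =
     ((snd ` black.field_of M, roots black.colour_graph (black.field_of M)),
      (snd ` white.field_of M, roots white.colour_graph (white.field_of M)))"

text \<open>In each colour the forest and roots determine the field, and the field determines the
  corners of \<open>M\<close>. Conversely, orthogonal rooted forests give fields with disjoint edge
  sets, which assemble to a Morse matching.\<close>

lemma bij_betw_forests_of:
  "bij_betw forests_of {M. discrete_morse P M} (rooted_orthogonal_spanning_forests P)"
proof (rule bij_betw_imageI[OF inj_onI subset_antisym[OF subsetI subsetI]])
  fix M N assume MN: "M \<in> {M. discrete_morse P M}" "N \<in> {M. discrete_morse P M}"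
    and eq: "forests_of M = forests_of N"
  interpret M: morse_map P M using MN(1) by unfold_locales simp
  interpret N: morse_map P N using MN(2) by unfold_locales simp
  have "black.field_of M = black.field_of N"
    using black.gradient_field_eqI[OF M.bgrad.field N.bgrad.field] eq unfolding forests_of_def by simp
  moreover have "white.field_of M = white.field_of N"
    using white.gradient_field_eqI[OF M.wgrad.field N.wgrad.field] eq unfolding forests_of_def by simp
  ultimately show "M = N"
    using M.M_split N.M_split
      black.field_of_eq_corners[OF M.darts M.bgrad.field] black.field_of_eq_corners[OF N.darts N.bgrad.field]
      white.field_of_eq_corners[OF M.darts M.wgrad.field] white.field_of_eq_corners[OF N.darts N.wgrad.field]
    by simp
next
  fix x assume "x \<in> forests_of ` {M. discrete_morse P M}"
  then obtain M where M: "discrete_morse P M" "x = forests_of M" by blast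
  interpret morse_map P M by (rule morse_mapI[OF M(1)])
  show "x \<in> rooted_orthogonal_spanning_forests P"
    using bgrad.spanning_forest_field bgrad.rooting_roots wgrad.spanning_forest_field
      wgrad.rooting_roots edges_disjoint
    unfolding M(2) forests_of_def rooted_orthogonal_spanning_forests_def orthogonal_def colour_graphs
    by simp
next
  fix x assume "x \<in> rooted_orthogonal_spanning_forests P"
  then obtain F R F' R' where x: "x = ((F, R), (F', R'))" "F \<inter> F' = {}"
    "spanning_forest black.colour_graph F" "rooting black.colour_graph F R"
    "spanning_forest white.colour_graph F'" "rooting white.colour_graph F' R'"
    unfolding rooted_orthogonal_spanning_forests_def orthogonal_def colour_graphs by blast
  obtain A where A: "gradient_field black.colour_graph A" "snd ` A = F" "roots black.colour_graph A = R"
    using black.gradient_field_of_forest[OF x(3,4)] .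
  obtain B where B: "gradient_field white.colour_graph B" "snd ` B = F'" "roots white.colour_graph B = R'"
    using white.gradient_field_of_forest[OF x(5,6)] .
  obtain M where "discrete_morse P M" "black.field_of M = A" "white.field_of M = B"
    using morse_of_fields[OF A(1) B(1)] x(2) A(2) B(2) by metis
  then show "x \<in> forests_of ` {M. discrete_morse P M}"
    using A B x(1) unfolding forests_of_def by force
qed

lemma perfect_iff_maximal:
  "perfect P M \<longleftrightarrow> discrete_morse P M \<and> crossing_at P ` M = crossings P"
proof
  obtain A B r s where AB: "gradient_field black.colour_graph A" "roots black.colour_graph A = {r}"
    "gradient_field white.colour_graph B" "roots white.colour_graph B = {s}"
    "snd ` A \<inter> snd ` B = {}"
    by (rule orthogonal_spanning_tree_fields)
  \<comment> \<open>\<open>T\<close> has a single root in each colour and so two critical cells,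
    which bounds the minimum from above.\<close>
  obtain T where T: "discrete_morse P T" "black.field_of T = A" "white.field_of T = B"
    using morse_of_fields[OF AB(1,3,5)] .
  interpret T: morse_map P T by (rule morse_mapI[OF T(1)])
  assume M: "perfect P M"
  then interpret morse_map P M unfolding perfect_def by unfold_locales blast
  have "card (critical_cells P M) \<le> card (critical_cells P T)"
    using M T(1) unfolding perfect_def by blast
  also have "card (critical_cells P T) = 2"
    using T.card_critical_cells unfolding T(2,3) AB(2,4) by simp
  finally have "card black_roots + card white_roots \<le> 2"
    using card_critical_cells by simp
  then have "card black_roots = 1 \<and> card white_roots = 1" using roots_pos by arith
  then show "discrete_morse P M \<and> crossing_at P ` M = crossings P"
    using maximal_iff morse by blast
next
  assume M: "discrete_morse P M \<and> crossing_at P ` M = crossings P"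
  then interpret morse_map P M by unfold_locales simp
  have "card (critical_cells P M) \<le> card (critical_cells P N)" if N: "discrete_morse P N" for N
  proof -
    interpret N: morse_map P N by (rule morse_mapI[OF N])
    have "card black_roots = 1" "card white_roots = 1" using M maximal_iff by simp_all
    then have "card (critical_cells P M) = 2" using card_critical_cells by simp
    moreover have "2 \<le> card N.black_roots + card N.white_roots" using N.roots_pos by simp
    then have "2 \<le> card (critical_cells P N)" using N.card_critical_cells by simp
    ultimately show ?thesis by simp
  qed
  then show "perfect P M" using M unfolding perfect_def by blast
qed

text \<open>Both forests are trees exactly when each colour has one root, which is maximality of the
  matching.\<close>

lemma forests_of_tree_iff:
  assumes "discrete_morse P M"
  shows "forests_of M \<in> rooted_orthogonal_spanning_trees P \<longleftrightarrow> perfect P M"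
proof -
  interpret morse_map P M by (rule morse_mapI[OF assms])
  have "forests_of M \<in> rooted_orthogonal_spanning_trees P \<longleftrightarrow>
      spanning_tree black.colour_graph (snd ` black.field_of M) \<and>
      spanning_tree white.colour_graph (snd ` white.field_of M)"
    using bgrad.rooting_roots wgrad.rooting_roots edges_disjoint
    unfolding forests_of_def rooted_orthogonal_spanning_trees_def orthogonal_def colour_graphs
    by simp
  then show ?thesis
    using bgrad.spanning_tree_iff wgrad.spanning_tree_iff both_colours maximal_iff
      perfect_iff_maximal[of M] assms by simp
qed

lemma spanning_trees_subset_forests:
  "rooted_orthogonal_spanning_trees P \<subseteq> rooted_orthogonal_spanning_forests P"
  unfolding rooted_orthogonal_spanning_trees_def rooted_orthogonal_spanning_forests_def
    spanning_tree_def by auto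

text \<open>A pair of trees is a pair of forests, so it comes from some Morse matching, which then
  has to be perfect.\<close>

lemma bij_betw_trees:
  "bij_betw forests_of {M. perfect P M} (rooted_orthogonal_spanning_trees P)"
proof (rule bij_betw_subset[OF bij_betw_forests_of])
  show "{M. perfect P M} \<subseteq> {M. discrete_morse P M}" unfolding perfect_def by blast
  show "forests_of ` {M. perfect P M} = rooted_orthogonal_spanning_trees P"
  proof (intro subset_antisym subsetI)
    fix x assume "x \<in> forests_of ` {M. perfect P M}"
    then show "x \<in> rooted_orthogonal_spanning_trees P"
      using forests_of_tree_iff unfolding perfect_def by blast
  next
    fix x assume x: "x \<in> rooted_orthogonal_spanning_trees P"
    then obtain M where "discrete_morse P M" "x = forests_of M"
      using spanning_trees_subset_forests bij_betw_forests_of unfolding bij_betw_def by blast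
    then show "x \<in> forests_of ` {M. perfect P M}" using x forests_of_tree_iff by blast
  qed
qed

end

theorem theorem4p6:
  fixes P :: "'d projection"
  assumes "knot_projection P"
  shows "\<exists>\<Phi>. bij_betw \<Phi> (admissible_morse P) (rooted_orthogonal_spanning_forests P) \<and>
             maximal_admissible_morse P = {M. perfect P M} \<and>
             bij_betw \<Phi> {M. perfect P M} (rooted_orthogonal_spanning_trees P)"
proof -
  interpret knot_map P using assms by unfold_locales
  show ?thesis
    using bij_betw_forests_of bij_betw_trees perfect_iff_maximal
    unfolding admissible_morse_eq maximal_admissible_morse_eq by blast
qed

end
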